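(* Let $k\ge2$ be an integer, $0<t<1$, and $a>1$. Suppose that $B_0$, $B_1$, and $B_2$ are finite Blaschke products such that $$\deg B_0=k-1,\quad\deg B_1=k,\quad\deg B_2=k-2,$$ and the function $1-ta^2B_1B_2$ vanishes at the zeros of $B_0$ (counted with multiplicities). Let $$\Psi=\begin{pmatrix}\frac1{B_0}&a\\-a&B_0\end{pmatrix}\begin{pmatrix}\frac{B_0}{B_1}&0\\0&t\frac{B_2}{B_0}\end{pmatrix}\begin{pmatrix}\frac1{B_0}&a\\-a&B_0\end{pmatrix}$$ and let $\Phi=\mathbb P_-\Psi$. Then $\deg\Phi=k$ and $\deg\mathcal A\Phi=2k-3$, where $\mathcal A\Phi$ is the unique superoptimal approximant of $\Phi$ by bounded analytic matrix functions.
   Context: $\mathbb D$ is the open unit disk, $\mathbb T$ the unit circle, $\hat{\mathbb C}$ the Riemann sphere, $\mathbb M_{m,n}$ the space of complex $m\times n$ matrices with the operator norm. A finite Blaschke product of degree $d$ is a function $c\prod_{j=1}^d\frac{\lambda_j-z}{1-\bar\lambda_jz}$ with $|c|=1$, $\lambda_j\in\mathbb D$. For a matrix function $\Phi$ on $\mathbb T$ with Fourier coefficients $\hat\Phi(j)$, $(\mathbb P_+\Phi)(z)=\sum_{j\ge0}\hat\Phi(j)z^j$ and $\mathbb P_-\Phi=\Phi-\mathbb P_+\Phi$. Superoptimal approximation: $s_j(A)$ denotes the $j$th singular value of a matrix $A$ ($j\ge 0$; distance in operator norm from $A$ to matrices of rank at most $j$). For $\Phi\in L^\infty(\mathbb M_{2,2})$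 on $\mathbb T$, let $\Omega_0$ be the set of $F\in H^\infty(\mathbb M_{2,2})$ minimizing $\operatorname{ess\,sup}_{\zeta\in\mathbb T}\|\Phi(\zeta)-F(\zeta)\|$ and let $\Omega_1$ be the set of $F\in\Omega_0$ minimizing $\operatorname{ess\,sup}_{\zeta\in\mathbb T}s_1(\Phi(\zeta)-F(\zeta))$. Elements of $\Omega_1$ are the superoptimal approximants of $\Phi$. It is known that for continuous $\Phi$ there is a unique superoptimal approximant, denoted $\mathcal A\Phi$, and that it is rational if $\Phi$ is rational without poles on $\mathbb T$. McMillan degree: a finite Blaschke–Potapov product of size $n\times n$ is $B=UB_1\cdots B_k$ with $U$ a constant unitary matrix and $B_j(z)=\frac{\lambda_j-z}{1-\bar\lambda_jz}P_j+(I-P_j)$, $\lambda_j\in\mathbb D$, $P_j$ orthogonal projections on $\mathbb C^n$; $\deg B=\sum_j\operatorname{rank}P_j$. If all poles (in $\hat{\mathbb C}$) of a rational $m\times n$ matrix function $\Phi$ lie in $\mathbb D$, $\deg\Phi$ is the smallest degree of an $n\times n$ finite Blaschke–Potapov product $B$ such that $\Phi B$ is bounded and analytic in $\mathbb D$ (constants have degree $0$). If $\Phi$ has no poles in the closed unit disk, $\deg\Phi=\deg\Phi_\flat$ with $\Phi_\flat(z)=\Phi(1/z)$. *)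

theory Defs
  imports "HOL-Probability.Essential_Supremum" "HOL-Complex_Analysis.Complex_Analysis"
begin

section \<open>Blaschke and Blaschke--Potapov products\<close>

definition blaschke_factor :: "complex \<Rightarrow> complex \<Rightarrow> complex" where
  "blaschke_factor w z = (w - z) / (1 - cnj w * z)"

text \<open>A finite Blaschke product is a function on all of \<open>complex\<close>; at its finitely many poles,
  which lie outside the closed unit disk, its value is the conventional \<open>x / 0 = 0\<close>.\<close>

definition finite_blaschke :: "nat \<Rightarrow> (complex \<Rightarrow> complex) \<Rightarrow> bool" where
  "finite_blaschke d B \<longleftrightarrow>
     (\<exists>c ls. norm c = 1 \<and> length ls = d \<and> set ls \<subseteq> ball 0 1 \<and>
        B = (\<lambda>z. c * (\<Prod>w\<leftarrow>ls. blaschke_factor w z)))"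

definition hermitian_adjoint :: "complex^'n^'m \<Rightarrow> complex^'m^'n" where
  "hermitian_adjoint A = map_matrix cnj (transpose A)"

definition unitary_matrix :: "complex^'n^'n \<Rightarrow> bool" where
  "unitary_matrix U \<longleftrightarrow>
     hermitian_adjoint U ** U = mat 1 \<and> U ** hermitian_adjoint U = mat 1"

definition orthogonal_projection_matrix :: "complex^'n^'n \<Rightarrow> bool" where
  "orthogonal_projection_matrix P \<longleftrightarrow> P ** P = P \<and> hermitian_adjoint P = P"

text \<open>\<open>blaschke_potapov d B\<close>: \<open>B\<close> is a finite Blaschke--Potapov product of degree \<open>d\<close>.
  The matrix \<open>mat c ** P\<close> is the scalar multiple \<open>c P\<close>.\<close>

inductive blaschke_potapov :: "nat \<Rightarrow> (complex \<Rightarrow> complex^'n^'n) \<Rightarrow> bool" where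
  const: "unitary_matrix U \<Longrightarrow> blaschke_potapov 0 (\<lambda>z. U)"
| factor: "\<lbrakk>blaschke_potapov d B; w \<in> ball 0 1; orthogonal_projection_matrix P\<rbrakk> \<Longrightarrow>
    blaschke_potapov (d + rank P)
      (\<lambda>z. B z ** (mat (blaschke_factor w z) ** P + (mat 1 - P)))"


section \<open>Rational matrix functions and McMillan degree\<close>

definition bounded_analytic_on_disk :: "(complex \<Rightarrow> complex^'n^'m) \<Rightarrow> bool" where
  "bounded_analytic_on_disk G \<longleftrightarrow>
     (\<forall>i j. (\<lambda>z. G z $ i $ j) holomorphic_on ball 0 1) \<and> bounded (G ` ball 0 1)"

text \<open>A rational function is represented by a function on \<open>complex\<close> whose values at finitely many
  points are irrelevant; all notions below are insensitive to them (\<open>is_pole f a\<close> only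
  depends on \<open>f\<close> in a punctured neighbourhood of \<open>a\<close>).\<close>

definition rational_matrix_fun :: "(complex \<Rightarrow> complex^'n^'m) \<Rightarrow> bool" where
  "rational_matrix_fun R \<longleftrightarrow>
     (\<forall>i j. \<exists>p q :: complex poly. q \<noteq> 0 \<and>
        (\<forall>z. poly q z \<noteq> 0 \<longrightarrow> R z $ i $ j = poly p z / poly q z))"

definition flat :: "(complex \<Rightarrow> complex^'n^'m) \<Rightarrow> complex \<Rightarrow> complex^'n^'m" where
  "flat R z = R (1 / z)"

definition matrix_pole :: "(complex \<Rightarrow> complex^'n^'m) \<Rightarrow> complex \<Rightarrow> bool" where
  "matrix_pole R a \<longleftrightarrow> (\<exists>i j. is_pole (\<lambda>z. R z $ i $ j) a)"

text \<open>The point at infinity is a pole of \<open>R\<close> iff \<open>0\<close> is a pole of \<open>flat R\<close>.\<close>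

definition all_poles_in_disk :: "(complex \<Rightarrow> complex^'n^'m) \<Rightarrow> bool" where
  "all_poles_in_disk R \<longleftrightarrow>
     (\<forall>a. matrix_pole R a \<longrightarrow> a \<in> ball 0 1) \<and> \<not> matrix_pole (flat R) 0"

definition no_poles_in_closed_disk :: "(complex \<Rightarrow> complex^'n^'m) \<Rightarrow> bool" where
  "no_poles_in_closed_disk R \<longleftrightarrow> (\<forall>a\<in>cball 0 1. \<not> matrix_pole R a)"

text \<open>The degree of a rational \<open>R\<close> all of whose poles lie in the disk. That the product of \<open>R\<close> and \<open>B\<close>
  is bounded and analytic in the disk is meant up to removable singularities.\<close>

definition disk_degree :: "(complex \<Rightarrow> complex^'n^'m) \<Rightarrow> nat" where
  "disk_degree R = (LEAST d. \<exists>(B :: complex \<Rightarrow> complex^'n^'n) G.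
     blaschke_potapov d B \<and> bounded_analytic_on_disk G \<and>
     finite {z \<in> ball 0 1. G z \<noteq> R z ** B z})"

text \<open>The two cases overlap only for constant functions, where both give degree \<open>0\<close>.\<close>

definition rational_degree :: "(complex \<Rightarrow> complex^'n^'m) \<Rightarrow> nat \<Rightarrow> bool" where
  "rational_degree R d \<longleftrightarrow> rational_matrix_fun R \<and>
     (all_poles_in_disk R \<and> disk_degree R = d \<or>
      no_poles_in_closed_disk R \<and> disk_degree (flat R) = d)"


section \<open>Functions on the unit circle\<close>

text \<open>Normalized arc length measure on the unit circle. Functions on the circle are functions
  on \<open>complex\<close> whose values off the circle are irrelevant.\<close>

definition circle :: "complex measure" where
  "circle = distr (uniform_measure lborel {0..2 * pi})
     (restrict_space borel (sphere 0 1)) cis"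

definition fourier_coeff :: "(complex \<Rightarrow> complex^'n^'m) \<Rightarrow> int \<Rightarrow> complex^'n^'m" where
  "fourier_coeff F j = (\<chi> i l. LINT \<zeta>|circle. \<zeta> powi (- j) * F \<zeta> $ i $ l)"

definition P_plus :: "(complex \<Rightarrow> complex^'n^'m) \<Rightarrow> complex \<Rightarrow> complex^'n^'m" where
  "P_plus F z = (\<chi> i l. \<Sum>j. fourier_coeff F (int j) $ i $ l * z ^ j)"

definition P_minus :: "(complex \<Rightarrow> complex^'n^'m) \<Rightarrow> complex \<Rightarrow> complex^'n^'m" where
  "P_minus F z = F z - P_plus F z"

text \<open>The degree of a function on the circle which coincides there with a rational function.\<close>

definition mcmillan_degree :: "(complex \<Rightarrow> complex^'n^'m) \<Rightarrow> nat \<Rightarrow> bool" where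
  "mcmillan_degree F d \<longleftrightarrow> (\<exists>R. (AE \<zeta> in circle. R \<zeta> = F \<zeta>) \<and> rational_degree R d)"

definition op_norm :: "complex^'n^'m \<Rightarrow> real" where
  "op_norm A = onorm ((*v) A)"

definition singular_value :: "nat \<Rightarrow> complex^'n^'m \<Rightarrow> real" where
  "singular_value j A = Inf {op_norm (A - K) | K. rank K \<le> j}"

definition Linf :: "(complex \<Rightarrow> complex^'n^'m) set" where
  "Linf = {F \<in> borel_measurable circle. esssup circle (\<lambda>\<zeta>. ereal (op_norm (F \<zeta>))) < \<infinity>}"

text \<open>Boundary functions of bounded analytic functions in the disk.\<close>

definition Hinf :: "(complex \<Rightarrow> complex^'n^'m) set" where
  "Hinf = {F \<in> Linf. \<exists>G. bounded_analytic_on_disk G \<and>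
     (AE \<zeta> in circle. ((\<lambda>r. G (of_real r * \<zeta>)) \<longlongrightarrow> F \<zeta>) (at_left 1))}"


section \<open>Superoptimal approximation of \<open>2 \<times> 2\<close> matrix functions\<close>

definition Omega0 :: "(complex \<Rightarrow> complex^2^2) \<Rightarrow> (complex \<Rightarrow> complex^2^2) set" where
  "Omega0 \<Phi> = {F. is_arg_min
     (\<lambda>F. esssup circle (\<lambda>\<zeta>. ereal (op_norm (\<Phi> \<zeta> - F \<zeta>)))) (\<lambda>F. F \<in> Hinf) F}"

definition Omega1 :: "(complex \<Rightarrow> complex^2^2) \<Rightarrow> (complex \<Rightarrow> complex^2^2) set" where
  "Omega1 \<Phi> = {F. is_arg_min
     (\<lambda>F. esssup circle (\<lambda>\<zeta>. ereal (singular_value 1 (\<Phi> \<zeta> - F \<zeta>)))) (\<lambda>F. F \<in> Omega0 \<Phi>) F}"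

definition unique_superoptimal_approximant ::
    "(complex \<Rightarrow> complex^2^2) \<Rightarrow> (complex \<Rightarrow> complex^2^2) \<Rightarrow> bool" where
  "unique_superoptimal_approximant \<Phi> A \<longleftrightarrow>
     A \<in> Omega1 \<Phi> \<and> (\<forall>F\<in>Omega1 \<Phi>. AE \<zeta> in circle. F \<zeta> = A \<zeta>)"

definition mat2 :: "'a::zero \<Rightarrow> 'a \<Rightarrow> 'a \<Rightarrow> 'a \<Rightarrow> 'a^2^2" where
  "mat2 a b c d = vector [vector [a, b], vector [c, d]]"

end

theory Submission
  imports Defs "HOL-Probability.Probability_Measure"
begin

(* "$" is reserved for the components of vectors and matrices. *)
no_notation fps_nth (infixl "$" 75)

text \<open>
  Write \<open>\<Psi> = W D W\<close> with \<open>W\<close> the left and right factor and \<open>D = diag (B\<^sub>0/B\<^sub>1, t B\<^sub>2/B\<^sub>0)\<close>. On the circle \<open>W\<close> is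
  \<open>sqrt (1 + a\<^sup>2)\<close> times a unitary matrix, so \<open>\<Psi>\<close> has the constant singular values \<open>1 + a\<^sup>2\<close> and
  \<open>t (1 + a\<^sup>2)\<close> there. Since \<open>\<Phi> = \<Psi> - P\<^sub>+ \<Psi>\<close> and \<open>P\<^sub>+ \<Psi>\<close> is rational and analytic on the closed disk,
  approximating \<open>\<Phi>\<close> by bounded analytic functions is the same as approximating \<open>\<Psi>\<close>, and the whole
  point is that the zero function is the unique superoptimal approximant of \<open>\<Psi>\<close>. The
  superoptimal approximant of \<open>\<Phi>\<close> is then \<open>- P\<^sub>+ \<Psi>\<close>.

  \<^bold>\<open>Why zero is superoptimal.\<close> Both diagonal entries of \<open>D\<close> have winding number \<open>-1\<close>. For the
  first this provides an analytic multiple \<open>x\<close> of the vector \<open>(B\<^sub>0, a)\<close> for which \<open>\<Psi> x\<close> has the maximal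
  length \<open>(1 + a\<^sup>2) |x|\<close> and its complex conjugate is \<open>\<zeta>\<close> times an analytic function, so that
  \<open>\<Psi> x\<close> is orthogonal to all analytic functions. If \<open>F\<close> is bounded analytic with
  \<open>\<parallel>\<Psi> - F\<parallel> \<le> 1 + a\<^sup>2\<close>, then \<open>|\<Psi> x - F x| \<le> |\<Psi> x|\<close>, and integrating the expanded square gives
  \<open>\<integral> |F x|\<^sup>2 \<le> 0\<close>, hence \<open>F x = 0\<close> (\<open>error_orthogonal_vanishes\<close>, \<open>extremal_vector_annihilated\<close>). The
  same argument for the transposed matrices leaves only \<open>\<Psi> - F = W diag (B\<^sub>0/B\<^sub>1, t B\<^sub>2/B\<^sub>0 + f) W\<close>
  with one unknown scalar analytic function \<open>f\<close> (\<open>F_structure\<close>). A second singular value of at most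
  \<open>t (1 + a\<^sup>2)\<close> means \<open>|t B\<^sub>2/B\<^sub>0 + f| \<le> t\<close>, and the scalar form of the argument, applied to the second
  diagonal entry, gives \<open>f = 0\<close> (\<open>superoptimal_error_unique\<close>).

  \<^bold>\<open>Why the degrees are \<open>k\<close> and \<open>2k - 3\<close>.\<close> Suppose that \<open>R = M/b + C\<close> with \<open>M\<close>, \<open>C\<close> analytic, \<open>b\<close> a
  finite Blaschke product of degree \<open>n\<close>, that \<open>b\<close> divides \<open>det M\<close>, and that some entry of \<open>M\<close> has no zero
  in common with \<open>b\<close>. Then \<open>R\<close> has degree \<open>n\<close> (\<open>disk_degree_eqI\<close>): the divisibility allows
  one to cancel the zeros of \<open>b\<close> one at a time by Blaschke--Potapov factors of rank one, and the
  entry forces \<open>b\<close> to divide \<open>det B\<close> for every admissible \<open>B\<close>. For \<open>\<Phi>\<close> this applies with \<open>b = B\<^sub>1\<close>: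
  the hypothesis on the zeros of \<open>B\<^sub>0\<close> makes \<open>B\<^sub>1 \<Psi>\<close> analytic, and
  \<open>det (B\<^sub>1 \<Psi>) = (1 + a\<^sup>2)\<^sup>2 t B\<^sub>1 B\<^sub>2\<close>. For \<open>P\<^sub>+ \<Psi>\<close> one reflects at the circle, which turns \<open>B\<^sub>j\<close> into the
  reciprocal of a Blaschke product \<open>b\<^sub>j\<close> of the same degree; now \<open>b = b\<^sub>0 b\<^sub>2\<close>, of degree
  \<open>(k - 1) + (k - 2)\<close>. There is no cancellation, because the lower right entry \<open>t - a\<^sup>2 b\<^sub>1 b\<^sub>2\<close> of
  the numerator equals \<open>t\<close> at the zeros of \<open>b\<^sub>2\<close> and \<open>t - 1/t\<close> at those of \<open>b\<^sub>0\<close>.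
\<close>

section \<open>Integration over the circle\<close>

lemma space_circle [simp]: "space circle = sphere 0 1"
  by (simp add: circle_def space_restrict_space)

lemma sets_circle: "sets circle = sets (restrict_space borel (sphere 0 1))"
  by (simp add: circle_def)

lemma borel_measurable_circle_continuous:
  "continuous_on (sphere 0 1) f \<Longrightarrow> f \<in> borel_measurable circle"
  using borel_measurable_continuous_on_restrict measurable_cong_sets[OF sets_circle refl]
  by blast

lemma measurable_cis_circle:
  "cis \<in> measurable (uniform_measure lborel {0..2 * pi}) (restrict_space borel (sphere 0 1))"
  by (intro measurable_restrict_space2)
     (auto simp: uniform_measure_def intro!: borel_measurable_continuous_onI continuous_intros)

interpretation circle: prob_space circle
  unfolding circle_def
  by (intro prob_space.prob_space_distr measurable_cis_circle prob_space_uniform_measure) auto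

lemma integral_circle:
  fixes f :: "complex \<Rightarrow> complex"
  assumes f: "continuous_on (sphere 0 1) f"
  shows "(LINT z|circle. f z) = integral {0..2 * pi} (\<lambda>t. f (cis t)) / (2 * pi)"
proof -
  have c: "continuous_on {0..2*pi} (\<lambda>t. f (cis t))"
    by (rule continuous_on_compose2[OF f]) (auto intro!: continuous_intros)
  have ui: "uniform_measure lborel {0..2 * pi}
      = density lborel (\<lambda>t. ennreal (indicator {0..2*pi} t / (2*pi)))"
    unfolding uniform_measure_def
    by (rule density_cong)
       (auto simp: indicator_def divide_ennreal simp flip: ennreal_1 split: if_splits)
  have "(LINT z|circle. f z) = (LINT t|uniform_measure lborel {0..2 * pi}. f (cis t))"
    unfolding circle_def
    by (rule integral_distr[OF measurable_cis_circle])
       (rule borel_measurable_continuous_on_restrict[OF f])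
  also have "\<dots> = (LINT t|lborel. (indicator {0..2*pi} t / (2*pi)) *\<^sub>R f (cis t))"
    unfolding ui
  proof (rule integral_density)
    show "(\<lambda>t. f (cis t)) \<in> borel_measurable lborel"
    proof -
      have "continuous_on UNIV (\<lambda>t. f (cis t))"
        by (rule continuous_on_compose2[OF f]) (auto intro!: continuous_intros)
      then show ?thesis
        by (simp add: borel_measurable_continuous_onI)
    qed
  qed auto
  also have "\<dots> = (LINT t|lborel. (1/(2*pi)) *\<^sub>R (indicator {0..2*pi} t *\<^sub>R f (cis t)))"
    by (rule Bochner_Integration.integral_cong) auto
  also have "\<dots> = (1/(2*pi)) *\<^sub>R (LINT t:{0..2*pi}|lborel. f (cis t))"
    by (subst integral_scaleR_right) (auto simp: set_lebesgue_integral_def)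
  also have "(LINT t:{0..2*pi}|lborel. f (cis t)) = integral {0..2*pi} (\<lambda>t. f (cis t))"
    using borel_integrable_atLeastAtMost'[OF c] by (rule set_borel_integral_eq_integral)
  finally show ?thesis
    by (simp add: scaleR_conv_of_real)
qed

lemma integrable_circle_bounded:
  fixes f :: "complex \<Rightarrow> complex"
  assumes "f \<in> borel_measurable circle" "AE z in circle. norm (f z) \<le> C"
  shows "integrable circle f"
  by (rule circle.integrable_const_bound[OF assms(2,1)])

lemma integrable_circle_continuous:
  fixes f :: "complex \<Rightarrow> complex"
  assumes "continuous_on (sphere 0 1) f"
  shows "integrable circle f"
proof -
  have "compact (f ` sphere 0 1)"
    using assms by (rule compact_continuous_image) simp
  then obtain C where "\<forall>z\<in>sphere 0 1. norm (f z) \<le> C"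
    by (metis bounded_iff compact_imp_bounded imageI)
  then show ?thesis
    by (intro integrable_circle_bounded[of _ C] borel_measurable_circle_continuous assms AE_I2) auto
qed

text \<open>Cauchy's formula for the Taylor coefficients, read as a statement on Fourier coefficients.\<close>

lemma integral_circle_taylor:
  assumes f: "continuous_on (cball 0 1) f" "f holomorphic_on ball 0 1"
  shows "(LINT z|circle. z powi (- int j) * f z) = (deriv ^^ j) f 0 / fact j"
proof -
  let ?D = "(deriv ^^ j) f 0 / fact j"
  have fs: "continuous_on (sphere 0 1) f"
    by (rule continuous_on_subset[OF f(1)]) auto
  have "((\<lambda>u. f u / u ^ Suc j) has_contour_integral ((2 * pi * \<i>) / fact j * (deriv ^^ j) f 0))
      (circlepath 0 1)"
    using Cauchy_has_contour_integral_higher_derivative_circlepath[OF f, of 0 j] by simp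
  then have "((\<lambda>t. f (cis t) / cis t ^ Suc j * \<i> * cis t) has_integral ((2 * pi * \<i>) * ?D)) {0..2*pi}"
    by (simp add: circlepath_def has_contour_integral_part_circlepath_iff)
  then have "((\<lambda>t. (1/\<i>) * (f (cis t) / cis t ^ Suc j * \<i> * cis t)) has_integral (1/\<i>) * ((2 * pi * \<i>) * ?D)) {0..2*pi}"
    by (rule has_integral_mult_right)
  moreover have "(1/\<i>) * (f (cis t) / cis t ^ Suc j * \<i> * cis t) = cis t powi (- int j) * f (cis t)" for t
    by (simp add: power_int_minus field_simps)
  moreover have "(1/\<i>) * ((2 * pi * \<i>) * ?D) = 2 * pi * ?D"
  proof -
    have "(1 / c) * ((a * c) * D) = a * D" if "c \<noteq> 0" for a c D :: complex
      using that by simp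
    from this[OF complex_i_not_zero] show ?thesis .
  qed
  ultimately have "integral {0..2*pi} (\<lambda>t. cis t powi (- int j) * f (cis t)) = 2 * pi * ?D"
    by (simp only: integral_unique)
  moreover have "continuous_on (sphere 0 1) (\<lambda>z. z powi (- int j) * f z)"
    by (auto intro!: continuous_intros fs)
  ultimately show ?thesis
    by (simp add: integral_circle)
qed

lemma integral_circle_mean_value:
  assumes f: "continuous_on (cball 0 1) f" "f holomorphic_on ball 0 1"
  shows "(LINT z|circle. f z) = f 0"
  using integral_circle_taylor[OF assms, of 0] by simp

section \<open>Boundary values and orthogonality\<close>

text \<open>\<open>e\<close> is the function of radial limits of the bounded analytic function \<open>G\<close>; this is the scalar
  form of membership in \<open>Hinf\<close>, with the extension into the disk made explicit.\<close>

definition boundary_function :: "(complex \<Rightarrow> complex) \<Rightarrow> (complex \<Rightarrow> complex) \<Rightarrow> bool" where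
  "boundary_function G e \<longleftrightarrow> G holomorphic_on ball 0 1 \<and> bounded (G ` ball 0 1) \<and>
     e \<in> borel_measurable circle \<and>
     (AE \<zeta> in circle. ((\<lambda>r. G (of_real r * \<zeta>)) \<longlongrightarrow> e \<zeta>) (at_left 1))"

lemma boundary_function_limit:
  "boundary_function G e \<Longrightarrow>
     AE \<zeta> in circle. ((\<lambda>r. G (of_real r * \<zeta>)) \<longlongrightarrow> e \<zeta>) (at_left 1)"
  by (simp add: boundary_function_def)

lemma boundary_function_bound:
  assumes "boundary_function G e"
  obtains C where "\<And>z. z \<in> ball 0 1 \<Longrightarrow> norm (G z) \<le> C"
  using assms unfolding boundary_function_def bounded_iff by blast

lemma analytic_imp_bounded_on_disk:
  assumes "f analytic_on cball 0 (1::real)"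
  shows "bounded (f ` ball 0 1)"
proof -
  have "compact (f ` cball 0 1)"
    using assms by (intro compact_continuous_image analytic_imp_holomorphic
        holomorphic_on_imp_continuous_on) auto
  then show ?thesis
    using bounded_subset[OF compact_imp_bounded] ball_subset_cball by (metis image_mono)
qed

lemma at_left_1_unit_interval: "\<forall>\<^sub>F r in at_left (1::real). 0 < r \<and> r < 1"
  using eventually_at_left_real[of 0 1] by simp

lemma boundary_function_analytic:
  assumes "f analytic_on cball 0 1"
  shows "boundary_function f f"
proof -
  have hol: "f holomorphic_on cball 0 1"
    by (rule analytic_imp_holomorphic[OF assms])
  have cont: "continuous_on (cball 0 1) f"
    by (rule holomorphic_on_imp_continuous_on[OF hol])
  have "((\<lambda>r. f (of_real r * \<zeta>)) \<longlongrightarrow> f \<zeta>) (at_left 1)" if "\<zeta> \<in> sphere 0 1" for \<zeta>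
  proof (rule continuous_on_tendsto_compose[OF cont])
    have "((\<lambda>r. of_real r * \<zeta>) \<longlongrightarrow> of_real 1 * \<zeta>) (at_left (1::real))"
      by (intro tendsto_intros)
    then show "((\<lambda>r. of_real r * \<zeta>) \<longlongrightarrow> \<zeta>) (at_left (1::real))" by simp
    show "\<zeta> \<in> cball 0 1" using that by auto
    show "\<forall>\<^sub>F r in at_left 1. of_real r * \<zeta> \<in> cball 0 1"
      using at_left_1_unit_interval by eventually_elim (use that in \<open>auto simp: norm_mult\<close>)
  qed
  then have "AE \<zeta> in circle. ((\<lambda>r. f (of_real r * \<zeta>)) \<longlongrightarrow> f \<zeta>) (at_left 1)"
    by (intro AE_I2) simp
  moreover have "f \<in> borel_measurable circle"
    by (intro borel_measurable_circle_continuous continuous_on_subset[OF cont]) auto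
  ultimately show ?thesis
    using holomorphic_on_subset[OF hol] analytic_imp_bounded_on_disk[OF assms]
    by (auto simp: boundary_function_def)
qed

lemma boundary_function_add:
  assumes "boundary_function G e" "boundary_function G' e'"
  shows "boundary_function (\<lambda>z. G z + G' z) (\<lambda>z. e z + e' z)"
proof -
  have "AE \<zeta> in circle. ((\<lambda>r. G (of_real r * \<zeta>) + G' (of_real r * \<zeta>)) \<longlongrightarrow> e \<zeta> + e' \<zeta>) (at_left 1)"
    using boundary_function_limit[OF assms(1)] boundary_function_limit[OF assms(2)]
    by eventually_elim (intro tendsto_add)
  then show ?thesis
    using assms unfolding boundary_function_def
    by (auto intro!: holomorphic_intros bounded_plus_comp)
qed

lemma boundary_function_mult:
  assumes "boundary_function G e" "boundary_function G' e'"
  shows "boundary_function (\<lambda>z. G z * G' z) (\<lambda>z. e z * e' z)"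
proof -
  have "AE \<zeta> in circle. ((\<lambda>r. G (of_real r * \<zeta>) * G' (of_real r * \<zeta>)) \<longlongrightarrow> e \<zeta> * e' \<zeta>) (at_left 1)"
    using boundary_function_limit[OF assms(1)] boundary_function_limit[OF assms(2)]
    by eventually_elim (intro tendsto_mult)
  moreover have "bounded ((\<lambda>z. G z * G' z) ` ball 0 1)"
  proof -
    obtain C C' where C: "\<And>z. z \<in> ball 0 1 \<Longrightarrow> norm (G z) \<le> C" "\<And>z. z \<in> ball 0 1 \<Longrightarrow> norm (G' z) \<le> C'"
      using boundary_function_bound[OF assms(1)] boundary_function_bound[OF assms(2)] by metis
    have "norm (G z * G' z) \<le> C * C'" if "z \<in> ball 0 1" for z
      unfolding norm_mult using C[OF that]
      by (intro mult_mono) (auto intro: order_trans[OF norm_ge_zero])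
    then show ?thesis unfolding bounded_iff by blast
  qed
  ultimately show ?thesis
    using assms unfolding boundary_function_def
    by (auto intro!: holomorphic_intros)
qed

lemma boundary_function_sum:
  assumes "\<And>i. i \<in> I \<Longrightarrow> boundary_function (G i) (e i)"
  shows "boundary_function (\<lambda>z. \<Sum>i\<in>I. G i z) (\<lambda>z. \<Sum>i\<in>I. e i z)"
  using assms
proof (induction I rule: infinite_finite_induct)
  case (insert i I)
  then show ?case using boundary_function_add by simp
qed (auto intro!: boundary_function_analytic)

lemma boundary_function_AE_bounded:
  assumes "boundary_function G e"
  obtains C where "AE \<zeta> in circle. norm (e \<zeta>) \<le> C"
proof -
  obtain C where C: "\<And>z. z \<in> ball 0 1 \<Longrightarrow> norm (G z) \<le> C"
    using boundary_function_bound[OF assms] by blast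
  have lim: "AE \<zeta> in circle. ((\<lambda>r. G (of_real r * \<zeta>)) \<longlongrightarrow> e \<zeta>) (at_left 1)"
    using assms unfolding boundary_function_def by simp
  have "AE \<zeta> in circle. norm (e \<zeta>) \<le> C"
    using lim AE_space
  proof eventually_elim
    case (elim \<zeta>)
    have "\<forall>\<^sub>F r in at_left 1. norm (G (of_real r * \<zeta>)) \<le> C"
      using at_left_1_unit_interval
      by eventually_elim (use elim(2) in \<open>auto intro!: C simp: norm_mult\<close>)
    then show ?case
      by (intro Lim_norm_ubound[OF _ elim(1)]) auto
  qed
  then show thesis using that by blast
qed

lemma boundary_function_integrable:
  assumes "boundary_function G e"
  shows "integrable circle e"
proof -
  obtain C where "AE \<zeta> in circle. norm (e \<zeta>) \<le> C"
    using boundary_function_AE_bounded[OF assms] .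
  then show ?thesis
    using assms by (intro integrable_circle_bounded) (auto simp: boundary_function_def)
qed

text \<open>The mean value property on the circles of radius \<open>r < 1\<close> survives the passage to the boundary
  by dominated convergence.\<close>

lemma boundary_function_integral:
  assumes bf: "boundary_function G e"
  shows "(LINT \<zeta>|circle. e \<zeta>) = G 0"
proof -
  define r where "r n = 1 - 1 / real (n + 2)" for n
  have r: "0 < r n" "r n < 1" for n
    by (auto simp: r_def)
  have G: "G holomorphic_on ball 0 1"
    using bf by (simp add: boundary_function_def)
  have "r \<longlonglongrightarrow> 1"
    unfolding r_def by real_asymp
  then have r1: "filterlim r (at_left 1) sequentially"
    unfolding filterlim_at using r by (auto intro!: always_eventually simp: less_imp_neq)
  obtain C where C: "\<And>z. z \<in> ball 0 1 \<Longrightarrow> norm (G z) \<le> C"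
    using boundary_function_bound[OF bf] by blast
  have in_ball: "of_real (r n) * z \<in> ball 0 1" if "z \<in> cball 0 1" for n and z :: complex
  proof -
    have "r n * norm z \<le> r n * 1"
      using that r[of n] by (intro mult_left_mono) auto
    also have "\<dots> < 1" using r[of n] by simp
    finally show ?thesis using r[of n] by (simp add: norm_mult)
  qed
  have hol: "(\<lambda>z. G (of_real (r n) * z)) holomorphic_on cball 0 1" for n
    by (rule holomorphic_on_compose_gen[OF _ G, unfolded o_def])
       (use in_ball in \<open>auto intro!: holomorphic_intros\<close>)
  have cont: "continuous_on (cball 0 1) (\<lambda>z. G (of_real (r n) * z))" for n
    by (rule holomorphic_on_imp_continuous_on[OF hol])
  have int: "(LINT \<zeta>|circle. G (of_real (r n) * \<zeta>)) = G 0" for n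
    using integral_circle_mean_value[OF cont holomorphic_on_subset[OF hol]] by auto
  have "(\<lambda>n. LINT \<zeta>|circle. G (of_real (r n) * \<zeta>)) \<longlonglongrightarrow> (LINT \<zeta>|circle. e \<zeta>)"
  proof (rule integral_dominated_convergence)
    show "e \<in> borel_measurable circle"
      using bf by (simp add: boundary_function_def)
    show "(\<lambda>\<zeta>. G (of_real (r n) * \<zeta>)) \<in> borel_measurable circle" for n
      by (intro borel_measurable_circle_continuous continuous_on_subset[OF cont]) auto
    show "integrable circle (\<lambda>_. C)" by simp
    have "AE \<zeta> in circle. ((\<lambda>r. G (of_real r * \<zeta>)) \<longlongrightarrow> e \<zeta>) (at_left 1)"
      using bf by (simp add: boundary_function_def)
    then show "AE \<zeta> in circle. (\<lambda>n. G (of_real (r n) * \<zeta>)) \<longlonglongrightarrow> e \<zeta>"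
      by eventually_elim (rule filterlim_compose[OF _ r1])
    show "AE \<zeta> in circle. norm (G (of_real (r n) * \<zeta>)) \<le> C" for n
      by (intro AE_I2 C in_ball) auto
  qed
  then show ?thesis
    unfolding int by (simp add: LIMSEQ_const_iff)
qed

text \<open>The duality argument behind all uniqueness statements below. The hypothesis on \<open>cnj (y i \<zeta>)\<close>
  says that \<open>y\<close> is orthogonal to the analytic functions, in particular to \<open>e\<close>. Hence
  \<open>\<integral> |y - e|\<^sup>2 = \<integral> |y|\<^sup>2 + \<integral> |e|\<^sup>2\<close>, and an error that is nowhere longer than \<open>y\<close> forces
  \<open>e = 0\<close>.\<close>

lemma error_orthogonal_vanishes:
  assumes fin: "finite I"
    and e: "\<And>i. i \<in> I \<Longrightarrow> boundary_function (G i) (e i)"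
    and g: "\<And>i. i \<in> I \<Longrightarrow> g i analytic_on cball 0 1"
    and y: "\<And>i \<zeta>. i \<in> I \<Longrightarrow> \<zeta> \<in> sphere 0 1 \<Longrightarrow> cnj (y i \<zeta>) = \<zeta> * g i \<zeta>"
    and le: "AE \<zeta> in circle. (\<Sum>i\<in>I. (cmod (y i \<zeta> - e i \<zeta>))\<^sup>2) \<le> (\<Sum>i\<in>I. (cmod (y i \<zeta>))\<^sup>2)"
  shows "AE \<zeta> in circle. \<forall>i\<in>I. e i \<zeta> = 0"
proof -
  define p where "p \<zeta> = (\<Sum>i\<in>I. e i \<zeta> * (\<zeta> * g i \<zeta>))" for \<zeta>
  define q where "q \<zeta> = (\<Sum>i\<in>I. e i \<zeta> * cnj (e i \<zeta>))" for \<zeta>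
  have p: "boundary_function (\<lambda>z. \<Sum>i\<in>I. G i z * (z * g i z)) p"
    unfolding p_def
    by (intro boundary_function_sum boundary_function_mult e boundary_function_analytic
          analytic_intros g)
  have int_p: "integrable circle p" "(LINT \<zeta>|circle. p \<zeta>) = 0"
    using boundary_function_integrable[OF p] boundary_function_integral[OF p] by simp_all
  have int_q: "integrable circle q"
    unfolding q_def
  proof (rule Bochner_Integration.integrable_sum)
    fix i assume i: "i \<in> I"
    obtain C where C: "AE \<zeta> in circle. norm (e i \<zeta>) \<le> C"
      using boundary_function_AE_bounded[OF e[OF i]] .
    have meas: "e i \<in> borel_measurable circle"
      using e[OF i] by (simp add: boundary_function_def)
    have meas': "(\<lambda>\<zeta>. cnj (e i \<zeta>)) \<in> borel_measurable circle"
      by (rule borel_measurable_continuous_on[OF _ meas]) (auto intro!: continuous_intros)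
    have "AE \<zeta> in circle. norm (e i \<zeta> * cnj (e i \<zeta>)) \<le> C * C"
      using C by eventually_elim
        (auto simp: norm_mult intro!: mult_mono order_trans[OF norm_ge_zero])
    then show "integrable circle (\<lambda>\<zeta>. e i \<zeta> * cnj (e i \<zeta>))"
      using meas meas' by (intro integrable_circle_bounded borel_measurable_times)
  qed
  have q: "Re (q \<zeta>) = (\<Sum>i\<in>I. (cmod (e i \<zeta>))\<^sup>2)" for \<zeta>
    unfolding q_def Re_sum by (intro sum.cong refl, simp only: cmod_power2) (simp add: power2_eq_square)
  have expand: "(cmod (u - v))\<^sup>2 = (cmod u)\<^sup>2 + (cmod v)\<^sup>2 - 2 * Re (v * cnj u)" for u v
    by (simp only: cmod_power2) (simp add: power2_eq_square algebra_simps)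
  have "AE \<zeta> in circle. Re (q \<zeta>) \<le> 2 * Re (p \<zeta>)"
    using le AE_space
  proof eventually_elim
    case (elim \<zeta>)
    then have "Re (p \<zeta>) = (\<Sum>i\<in>I. Re (e i \<zeta> * cnj (y i \<zeta>)))"
      by (simp add: p_def y del: times_complex.sel)
    then show ?case
      using elim(1) unfolding expand q
      by (simp add: sum.distrib sum_subtractf flip: sum_distrib_left)
  qed
  then have "(LINT \<zeta>|circle. Re (q \<zeta>)) \<le> (LINT \<zeta>|circle. 2 * Re (p \<zeta>))"
    using int_p int_q by (intro integral_mono_AE) auto
  also have "\<dots> = 0"
    using int_p by simp
  finally have "(LINT \<zeta>|circle. Re (q \<zeta>)) = 0"
    by (intro antisym integral_nonneg_AE) (auto simp: q intro!: sum_nonneg)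
  moreover have "integrable circle (\<lambda>\<zeta>. Re (q \<zeta>))"
    using int_q by simp
  ultimately have "AE \<zeta> in circle. Re (q \<zeta>) = 0"
    using integral_nonneg_eq_0_iff_AE[of circle "\<lambda>\<zeta>. Re (q \<zeta>)"]
    by (simp add: q sum_nonneg)
  then show ?thesis
    by eventually_elim (use fin in \<open>simp add: q sum_nonneg_eq_0_iff\<close>)
qed

section \<open>Strictly proper rational functions\<close>

lemma poly_analytic_on [analytic_intros]:
  assumes "f analytic_on S"
  shows "(\<lambda>z. poly p (f z)) analytic_on S"
proof -
  have "poly p holomorphic_on UNIV"
    by (auto simp: holomorphic_on_def field_differentiable_def
        intro!: exI has_field_derivative_at_within[OF poly_DERIV])
  then have "poly p analytic_on f ` S"
    by (meson analytic_on_holomorphic open_UNIV subset_UNIV)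
  from analytic_on_compose[OF assms this] show ?thesis
    by (simp add: o_def)
qed

text \<open>The substitution \<open>z \<mapsto> 1/z\<close> replaces polynomials by their reflected polynomials; strict properness
  leaves at least one factor \<open>z\<close> over, and the reflected denominator has its zeros outside the closed
  disk.\<close>

lemma strictly_proper_at_infinity:
  fixes r P :: "complex poly"
  assumes deg: "degree r < degree P" and roots: "\<And>z. poly P z = 0 \<Longrightarrow> z \<in> ball 0 1"
  obtains g where "g analytic_on cball 0 1"
    "\<And>z. z \<noteq> 0 \<Longrightarrow> poly r (1 / z) / poly P (1 / z) = z * g z"
proof
  define m where "m = degree P - degree r - 1"
  define g where "g z = z ^ m * poly (reflect_poly r) z / poly (reflect_poly P) z" for z
  have P: "P \<noteq> 0" using deg by auto
  have refl: "poly (reflect_poly p) z = z ^ degree p * poly p (1 / z)" if "z \<noteq> 0" for p :: "complex poly" and z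
    using poly_reflect_poly_nz[OF that] by (simp add: inverse_eq_divide)
  have nz: "poly (reflect_poly P) z \<noteq> 0" if "z \<in> cball 0 1" for z
  proof (cases "z = 0")
    case False
    then have "1 / z \<notin> ball 0 1"
      using that by (simp add: norm_divide)
    then show ?thesis
      using roots False by (auto simp: refl)
  qed (use P in auto)
  show "g analytic_on cball 0 1"
    unfolding g_def using nz by (intro analytic_intros) auto
  show "poly r (1 / z) / poly P (1 / z) = z * g z" if "z \<noteq> 0" for z
  proof -
    have "degree P = Suc m + degree r"
      using deg by (simp add: m_def)
    then show ?thesis
      using that by (simp add: g_def refl power_add field_simps)
  qed
qed

text \<open>On the circle conjugation is the substitution \<open>\<zeta> \<mapsto> 1/\<zeta>\<close> combined with the conjugation of the
  coefficients. This is the source of all functions orthogonal to the analytic ones used here.\<close>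

lemma cnj_strictly_proper_on_circle:
  fixes r P :: "complex poly"
  assumes deg: "degree r < degree P" and roots: "\<And>z. poly P z = 0 \<Longrightarrow> z \<in> ball 0 1"
  obtains g where "g analytic_on cball 0 1"
    "\<And>\<zeta>. \<zeta> \<in> sphere 0 1 \<Longrightarrow> cnj (poly r \<zeta> / poly P \<zeta>) = \<zeta> * g \<zeta>"
proof -
  have dm: "degree (map_poly cnj p) = degree p" for p
    by (rule degree_map_poly) auto
  have deg': "degree (map_poly cnj r) < degree (map_poly cnj P)"
    using deg by (simp add: dm)
  have roots': "z \<in> ball 0 1" if "poly (map_poly cnj P) z = 0" for z
    using roots[of "cnj z"] that by simp
  obtain g where g: "g analytic_on cball 0 1"
    "\<And>z. z \<noteq> 0 \<Longrightarrow> poly (map_poly cnj r) (1 / z) / poly (map_poly cnj P) (1 / z) = z * g z"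
    using strictly_proper_at_infinity[OF deg' roots'] by blast
  have "cnj (poly r \<zeta> / poly P \<zeta>) = \<zeta> * g \<zeta>" if "\<zeta> \<in> sphere 0 1" for \<zeta>
  proof -
    have "\<zeta> \<noteq> 0" "cnj (1 / \<zeta>) = \<zeta>"
      using that by (auto simp: divide_conv_cnj)
    then show ?thesis
      using g(2)[of \<zeta>] by simp
  qed
  with g(1) that show thesis by blast
qed

lemma fourier_strictly_proper:
  fixes r P :: "complex poly"
  assumes deg: "degree r < degree P" and roots: "\<And>z. poly P z = 0 \<Longrightarrow> z \<in> ball 0 1"
  shows "(LINT \<zeta>|circle. \<zeta> powi (- int j) * (poly r \<zeta> / poly P \<zeta>)) = 0"
proof -
  obtain g where g: "g analytic_on cball 0 1"
    "\<And>\<zeta>. \<zeta> \<in> sphere 0 1 \<Longrightarrow> cnj (poly r \<zeta> / poly P \<zeta>) = \<zeta> * g \<zeta>"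
    using cnj_strictly_proper_on_circle[OF assms] by blast
  have bf: "boundary_function (\<lambda>z. z ^ Suc j * g z) (\<lambda>z. z ^ Suc j * g z)"
    by (intro boundary_function_analytic analytic_intros g)
  have "cnj (LINT \<zeta>|circle. \<zeta> powi (- int j) * (poly r \<zeta> / poly P \<zeta>))
     = (LINT \<zeta>|circle. cnj (\<zeta> powi (- int j) * (poly r \<zeta> / poly P \<zeta>)))"
    by (rule Bochner_Integration.integral_cnj[symmetric])
  also have "\<dots> = (LINT \<zeta>|circle. \<zeta> ^ Suc j * g \<zeta>)"
  proof (rule Bochner_Integration.integral_cong[OF refl])
    fix \<zeta> assume "\<zeta> \<in> space circle"
    then have z: "\<zeta> \<in> sphere 0 1" by simp
    then have "cnj (\<zeta> powi (- int j)) = \<zeta> ^ j"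
      using divide_conv_cnj[of "cnj \<zeta>" 1] by (simp add: power_int_minus inverse_eq_divide flip: power_one_over)
    then show "cnj (\<zeta> powi (- int j) * (poly r \<zeta> / poly P \<zeta>)) = \<zeta> ^ Suc j * g \<zeta>"
      by (simp only: complex_cnj_mult g(2)[OF z]) simp
  qed
  also have "\<dots> = 0"
    using boundary_function_integral[OF bf] by simp
  finally show ?thesis by simp
qed

text \<open>A function analytic on the closed disk is analytic on a larger disk, so its Taylor series still
  converges at the boundary points.\<close>

lemma fourier_series_analytic:
  assumes "f analytic_on cball 0 1" "\<zeta> \<in> sphere 0 1"
  shows "(\<lambda>j. (LINT z|circle. z powi (- int j) * f z) * \<zeta> ^ j) sums f \<zeta>"
proof -
  obtain T where T: "open T" "cball 0 1 \<subseteq> T" "f holomorphic_on T"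
    using assms(1) unfolding analytic_on_holomorphic by auto
  obtain \<epsilon> where \<epsilon>: "\<epsilon> > 0" "(\<Union>x\<in>cball 0 1. ball x \<epsilon>) \<subseteq> T"
    using compact_subset_open_imp_ball_epsilon_subset[OF compact_cball T(1,2)] by blast
  have "ball 0 (1 + \<epsilon>) \<subseteq> T"
  proof
    fix z :: complex assume z: "z \<in> ball 0 (1 + \<epsilon>)"
    show "z \<in> T"
    proof (cases "norm z \<le> 1")
      case True with T(2) show ?thesis by auto
    next
      case False
      have "z - sgn z = (norm z - 1) *\<^sub>R sgn z"
      proof -
        have "z \<noteq> 0" using False by (metis norm_zero zero_le_one)
        then have "norm z *\<^sub>R sgn z = z" by (simp add: sgn_div_norm)
        then show ?thesis by (simp add: scaleR_left_diff_distrib)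
      qed
      moreover have "z \<noteq> 0" using False by (metis norm_zero zero_le_one)
      ultimately have "dist (sgn z) z = norm z - 1"
        using False by (simp add: dist_norm norm_minus_commute norm_sgn)
      then have "z \<in> ball (sgn z) \<epsilon>"
        using z by simp
      moreover have "sgn z \<in> cball 0 1"
        by (simp add: norm_sgn)
      ultimately show ?thesis using \<epsilon>(2) by blast
    qed
  qed
  then have "f holomorphic_on ball 0 (1 + \<epsilon>)"
    using T(3) holomorphic_on_subset by blast
  then have "(\<lambda>j. (deriv ^^ j) f 0 / fact j * (\<zeta> - 0) ^ j) sums f \<zeta>"
    using assms(2) \<epsilon>(1) by (intro holomorphic_power_series) auto
  moreover have "f holomorphic_on cball 0 1"
    using assms(1) by (rule analytic_imp_holomorphic)
  then have "(LINT z|circle. z powi (- int j) * f z) = (deriv ^^ j) f 0 / fact j" for j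
    by (intro integral_circle_taylor holomorphic_on_imp_continuous_on)
       (auto intro: holomorphic_on_subset)
  ultimately show ?thesis by simp
qed

section \<open>Operator norm and singular values\<close>

lemma norm_matrix_vector_le: "norm (A *v x) \<le> op_norm A * norm x"
  for A :: "complex^'n^'m"
  unfolding op_norm_def by (rule onorm) simp

lemma op_norm_nonneg: "0 \<le> op_norm A" for A :: "complex^'n^'m"
  unfolding op_norm_def by (rule onorm_pos_le) simp

lemma op_norm_le:
  fixes A :: "complex^'n^'m"
  assumes "0 \<le> c" "\<And>x. norm (A *v x) \<le> c * norm x"
  shows "op_norm A \<le> c"
  unfolding op_norm_def using assms by (intro onorm_bound) auto

lemma op_norm_ge:
  fixes A :: "complex^'n^'m"
  assumes "x \<noteq> 0" "c * norm x \<le> norm (A *v x)"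
  shows "c \<le> op_norm A"
proof -
  have "c * norm x \<le> op_norm A * norm x"
    using assms(2) norm_matrix_vector_le order_trans by blast
  then show ?thesis using assms(1) by simp
qed

lemma norm_dot_le: "norm (\<Sum>i\<in>UNIV. x $ i * y $ i) \<le> norm x * norm y"
  for x y :: "complex^'n"
proof -
  have "norm (\<Sum>i\<in>UNIV. x $ i * y $ i) \<le> (\<Sum>i\<in>UNIV. \<bar>norm (x $ i)\<bar> * \<bar>norm (y $ i)\<bar>)"
    by (rule order_trans[OF norm_sum]) (simp add: norm_mult)
  also have "\<dots> \<le> norm x * norm y"
    unfolding norm_vec_def by (rule L2_set_mult_ineq)
  finally show ?thesis .
qed

text \<open>With \<open>y = transpose A x\<close> and \<open>w\<close> the conjugate of \<open>y\<close>, moving \<open>A\<close> to the other side gives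
  \<open>|y|\<^sup>2 = x \<bullet> A w\<close>, where \<open>\<bullet>\<close> is the bilinear product.\<close>

lemma op_norm_transpose_le: "op_norm (transpose A) \<le> op_norm A"
  for A :: "complex^'n^'m"
proof (rule op_norm_le[OF op_norm_nonneg])
  fix x :: "complex^'m"
  define y where "y = transpose A *v x"
  define w where "w = (\<chi> j. cnj (y $ j))"
  have w: "norm w = norm y"
    by (simp add: norm_vec_def w_def)
  have "complex_of_real ((norm y)\<^sup>2) = (\<Sum>j\<in>UNIV. y $ j * w $ j)"
    by (simp add: norm_vec_def L2_set_def sum_nonneg w_def complex_norm_square del: of_real_power)
  also have "\<dots> = (\<Sum>j\<in>UNIV. \<Sum>i\<in>UNIV. x $ i * (A $ i $ j * w $ j))"
    by (simp add: y_def matrix_vector_mult_def transpose_def sum_distrib_left sum_distrib_right mult_ac)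
  also have "\<dots> = (\<Sum>i\<in>UNIV. x $ i * (A *v w) $ i)"
    by (subst sum.swap) (simp add: matrix_vector_mult_def sum_distrib_left)
  finally have "(norm y)\<^sup>2 = norm (\<Sum>i\<in>UNIV. x $ i * (A *v w) $ i)"
    by (metis norm_of_real abs_of_nonneg zero_le_power2)
  also have "\<dots> \<le> norm x * norm (A *v w)"
    by (rule norm_dot_le)
  also have "\<dots> \<le> norm x * (op_norm A * norm y)"
    using norm_matrix_vector_le[of A w] by (simp add: w mult_left_mono)
  finally have "norm y * norm y \<le> (op_norm A * norm x) * norm y"
    by (simp add: power2_eq_square mult_ac)
  then have "norm y \<le> op_norm A * norm x"
    by (cases "norm y = 0") (auto simp: op_norm_nonneg)
  then show "norm (transpose A *v x) \<le> op_norm A * norm x"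
    by (simp add: y_def)
qed

lemma op_norm_le_norm: "op_norm A \<le> real CARD('m) * norm A" for A :: "complex^'n^'m"
proof (rule op_norm_le)
  fix x :: "complex^'n"
  have "norm (A *v x) \<le> (\<Sum>i\<in>UNIV. norm ((A *v x) $ i))"
    unfolding norm_vec_def by (rule L2_set_le_sum) simp
  also have "\<dots> \<le> (\<Sum>i\<in>(UNIV :: 'm set). norm A * norm x)"
  proof (rule sum_mono)
    fix i
    have "norm ((A *v x) $ i) \<le> norm (A $ i) * norm x"
      unfolding matrix_vector_mult_def using norm_dot_le[of "A $ i" x] by simp
    also have "\<dots> \<le> norm A * norm x"
      by (intro mult_right_mono Finite_Cartesian_Product.norm_nth_le) auto
    finally show "norm ((A *v x) $ i) \<le> norm A * norm x" .
  qed
  finally show "norm (A *v x) \<le> real CARD('m) * norm A * norm x" by simp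
qed simp

lemma continuous_on_op_norm [continuous_intros]:
  fixes f :: "'a::topological_space \<Rightarrow> complex^'n^'m"
  assumes "continuous_on S f"
  shows "continuous_on S (\<lambda>x. op_norm (f x))"
proof -
  have triangle: "op_norm A \<le> op_norm B + op_norm (A - B)" for A B :: "complex^'n^'m"
  proof (rule op_norm_le)
    fix x
    have "A *v x = B *v x + (A - B) *v x"
      by (simp add: matrix_vector_mult_diff_rdistrib)
    then have "norm (A *v x) \<le> norm (B *v x) + norm ((A - B) *v x)"
      by (simp add: norm_triangle_ineq)
    also have "\<dots> \<le> op_norm B * norm x + op_norm (A - B) * norm x"
      by (intro add_mono norm_matrix_vector_le)
    finally show "norm (A *v x) \<le> (op_norm B + op_norm (A - B)) * norm x"
      by (simp add: distrib_right)
  qed (simp add: op_norm_nonneg)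
  have "(real CARD('m))-lipschitz_on UNIV (op_norm :: complex^'n^'m \<Rightarrow> real)"
  proof (rule lipschitz_onI)
    fix A B :: "complex^'n^'m"
    have "op_norm A \<le> op_norm B + real CARD('m) * norm (A - B)"
      using triangle[of A B] op_norm_le_norm[of "A - B"] by linarith
    moreover have "op_norm B \<le> op_norm A + real CARD('m) * norm (A - B)"
      using triangle[of B A] op_norm_le_norm[of "B - A"] by (simp add: norm_minus_commute)
    ultimately show "dist (op_norm A) (op_norm B) \<le> real CARD('m) * dist A B"
      by (simp add: dist_norm abs_le_iff)
  qed simp
  then show ?thesis
    using continuous_on_compose2[OF lipschitz_on_continuous_on assms] by blast
qed

lemma rank_deficient_kernel:
  fixes K :: "'a::field^'n^'m"
  assumes "rank K < CARD('n)"
  obtains x where "x \<noteq> 0" "K *v x = 0"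
proof -
  have "vec.span (rows K) \<noteq> UNIV"
    using assms vec.dim_span[of "rows K"] by (metis nless_le row_rank_def_gen vec_dim_card)
  then have "\<not> (\<forall>x. K *v x = 0 \<longrightarrow> x = 0)"
    by (simp only: matrix_left_invertible_span_rows_gen[symmetric] matrix_left_invertible_ker not_False_eq_True)
  then show thesis
    using that by auto
qed

lemma singular_value_le:
  fixes A :: "complex^'n^'m"
  assumes "rank K \<le> j"
  shows "singular_value j A \<le> op_norm (A - K)"
  unfolding singular_value_def
  using assms op_norm_nonneg by (intro cInf_lower) (auto intro!: bdd_belowI[of _ 0])

text \<open>A matrix of too small rank has a kernel vector, on which it cannot approximate \<open>A\<close>.\<close>

lemma singular_value_ge:
  fixes A :: "complex^'n^'m"
  assumes j: "j < CARD('n)" and A: "\<And>x. m * norm x \<le> norm (A *v x)"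
  shows "m \<le> singular_value j A"
  unfolding singular_value_def
proof (rule cInf_greatest)
  have "rank (0 :: complex^'n^'m) \<le> card ({} :: (complex^'n) set)"
    unfolding row_rank_def_gen by (rule vec.dim_le_card) (auto simp: rows_def row_def vec_eq_iff)
  then show "{op_norm (A - K) |K. rank K \<le> j} \<noteq> {}"
    by (auto intro!: exI[of _ 0])
  fix s assume "s \<in> {op_norm (A - K) |K. rank K \<le> j}"
  then obtain K where K: "s = op_norm (A - K)" "rank K \<le> j" by auto
  then obtain x where x: "x \<noteq> 0" "K *v x = 0"
    using rank_deficient_kernel[of K] j by auto
  have "(A - K) *v x = A *v x"
    using x by (simp add: matrix_vector_mult_diff_rdistrib)
  then show "m \<le> s"
    unfolding K(1) using A by (intro op_norm_ge[OF x(1)]) simp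
qed

section \<open>Two by two matrices\<close>

lemma mat2_nth [simp]:
  "mat2 a b c d $ 1 $ 1 = a" "mat2 a b c d $ 1 $ 2 = b"
  "mat2 a b c d $ 2 $ 1 = c" "mat2 a b c d $ 2 $ 2 = d"
  by (simp_all add: mat2_def)

lemma mat2_eq_iff: "A = B \<longleftrightarrow> A $ 1 $ 1 = B $ 1 $ 1 \<and> A $ 1 $ 2 = B $ 1 $ 2 \<and>
    A $ 2 $ 1 = B $ 2 $ 1 \<and> A $ 2 $ 2 = B $ 2 $ 2" for A B :: "'a^2^2"
  by (auto simp: vec_eq_iff forall_2)

lemma vec2_eq_iff: "x = y \<longleftrightarrow> x $ 1 = y $ 1 \<and> x $ 2 = y $ 2" for x y :: "'a^2"
  by (auto simp: vec_eq_iff forall_2)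

lemma vec2_vector: "v = vector [v $ 1, v $ 2]" for v :: "complex^2"
  by (simp add: vec2_eq_iff)

lemma matrix_mult_2_nth: "(A ** B) $ i $ j = A $ i $ 1 * B $ 1 $ j + A $ i $ 2 * B $ 2 $ j"
  for A :: "'a::semiring_1^2^'m"
  by (simp add: matrix_matrix_mult_def sum_2)

lemma matrix_vector_mult_2_nth: "(A *v x) $ i = A $ i $ 1 * x $ 1 + A $ i $ 2 * x $ 2"
  for A :: "'a::semiring_1^2^'m"
  by (simp add: matrix_vector_mult_def sum_2)

lemma matrix_diff_rdistrib_2: "(A - B) ** C = A ** C - B ** C" for A B C :: "'a::ring_1^2^2"
  by (simp add: vec_eq_iff matrix_mult_2_nth algebra_simps)

lemma matrix_diff_ldistrib_2: "C ** (A - B) = C ** A - C ** B" for A B C :: "'a::ring_1^2^2"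
  by (simp add: vec_eq_iff matrix_mult_2_nth algebra_simps)

lemma norm_vec2: "(norm x)\<^sup>2 = (cmod (x $ 1))\<^sup>2 + (cmod (x $ 2))\<^sup>2" for x :: "complex^2"
  by (simp add: norm_vec_def L2_set_def sum_2)

section \<open>Diagonal matrices between two scaled unitary factors\<close>

text \<open>For unimodular \<open>b\<close> this is \<open>sqrt (1 + a\<^sup>2)\<close> times a unitary matrix.\<close>

definition frame :: "real \<Rightarrow> complex \<Rightarrow> complex^2^2" where
  "frame a b = mat2 (1 / b) (of_real a) (- of_real a) b"

definition framed_diag :: "real \<Rightarrow> complex \<Rightarrow> complex \<Rightarrow> complex \<Rightarrow> complex^2^2" where
  "framed_diag a b \<alpha> \<beta> = frame a b ** mat2 \<alpha> 0 0 \<beta> ** frame a b"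

lemma framed_diag_nth:
  assumes "b \<noteq> 0"
  shows "framed_diag a b \<alpha> \<beta> $ 1 $ 1 = \<alpha> / b\<^sup>2 - (of_real a)\<^sup>2 * \<beta>"
    "framed_diag a b \<alpha> \<beta> $ 1 $ 2 = of_real a * (\<alpha> / b + b * \<beta>)"
    "framed_diag a b \<alpha> \<beta> $ 2 $ 1 = - of_real a * (\<alpha> / b + b * \<beta>)"
    "framed_diag a b \<alpha> \<beta> $ 2 $ 2 = b\<^sup>2 * \<beta> - (of_real a)\<^sup>2 * \<alpha>"
  using assms by (auto simp: framed_diag_def frame_def matrix_mult_2_nth power2_eq_square field_simps)

lemma framed_diag_diff: "framed_diag a b \<alpha> \<beta> - framed_diag a b \<alpha>' \<beta>' = framed_diag a b (\<alpha> - \<alpha>') (\<beta> - \<beta>')" if "b \<noteq> 0"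
  using that by (simp add: mat2_eq_iff framed_diag_nth field_simps)

text \<open>After the substitution \<open>u = x\<^sub>1/b\<close>, which preserves absolute values, both components are those of a
  scaled rotation applied to \<open>(u, x\<^sub>2)\<close>.\<close>

lemma norm_frame:
  assumes "cmod b = 1"
  shows "norm (frame a b *v x) = sqrt (1 + a\<^sup>2) * norm x"
proof -
  define u where "u = x $ 1 / b"
  have b: "b \<noteq> 0" using assms by auto
  have 1: "(frame a b *v x) $ 1 = u + of_real a * x $ 2" "(frame a b *v x) $ 2 = b * (x $ 2 - of_real a * u)"
    using b by (auto simp: frame_def matrix_vector_mult_2_nth u_def field_simps)
  have u: "cmod (x $ 1) = cmod u"
    using assms by (simp add: u_def norm_divide)
  have "(norm (frame a b *v x))\<^sup>2 = (cmod (u + of_real a * x $ 2))\<^sup>2 + (cmod (x $ 2 - of_real a * u))\<^sup>2"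
    unfolding norm_vec2 1 by (simp add: norm_mult assms)
  also have "\<dots> = (1 + a\<^sup>2) * ((cmod u)\<^sup>2 + (cmod (x $ 2))\<^sup>2)"
    unfolding cmod_power2 by (simp add: power2_eq_square algebra_simps)
  also have "\<dots> = (sqrt (1 + a\<^sup>2) * norm x)\<^sup>2"
    by (simp add: power_mult_distrib norm_vec2 u)
  finally show ?thesis
    by (rule power2_eq_imp_eq) auto
qed

lemma norm_diag_ge:
  assumes "0 \<le> m" "m \<le> cmod \<alpha>" "m \<le> cmod \<beta>"
  shows "m * norm x \<le> norm (mat2 \<alpha> 0 0 \<beta> *v x)"
proof (rule power2_le_imp_le)
  have "m\<^sup>2 \<le> (cmod \<alpha>)\<^sup>2" "m\<^sup>2 \<le> (cmod \<beta>)\<^sup>2"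
    using assms by (auto intro: power_mono)
  then show "(m * norm x)\<^sup>2 \<le> (norm (mat2 \<alpha> 0 0 \<beta> *v x))\<^sup>2"
    by (simp add: norm_vec2 matrix_vector_mult_2_nth power_mult_distrib norm_mult distrib_left
        add_mono mult_right_mono)
qed simp

lemma norm_diag_le:
  assumes "cmod \<alpha> \<le> m" "cmod \<beta> \<le> m"
  shows "norm (mat2 \<alpha> 0 0 \<beta> *v x) \<le> m * norm x"
proof (rule power2_le_imp_le)
  have "(cmod \<alpha>)\<^sup>2 \<le> m\<^sup>2" "(cmod \<beta>)\<^sup>2 \<le> m\<^sup>2"
    using assms by (auto intro: power_mono)
  then show "(norm (mat2 \<alpha> 0 0 \<beta> *v x))\<^sup>2 \<le> (m * norm x)\<^sup>2"
    by (simp add: norm_vec2 matrix_vector_mult_2_nth power_mult_distrib norm_mult distrib_left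
        add_mono mult_right_mono)
  show "0 \<le> m * norm x"
    using order_trans[OF norm_ge_zero assms(1)] by simp
qed

lemma norm_framed_diag:
  assumes "cmod b = 1"
  shows "norm (framed_diag a b \<alpha> \<beta> *v x) =
      sqrt (1 + a\<^sup>2) * norm (mat2 \<alpha> 0 0 \<beta> *v (frame a b *v x))"
  unfolding framed_diag_def by (simp add: norm_frame[OF assms] flip: matrix_vector_mul_assoc)

lemma norm_framed_diag_ge:
  assumes "cmod b = 1" "0 \<le> m" "m \<le> cmod \<alpha>" "m \<le> cmod \<beta>"
  shows "(1 + a\<^sup>2) * m * norm x \<le> norm (framed_diag a b \<alpha> \<beta> *v x)"
proof -
  have "(1 + a\<^sup>2) * m * norm x = sqrt (1 + a\<^sup>2) * (m * (sqrt (1 + a\<^sup>2) * norm x))"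
    by simp
  also have "\<dots> = sqrt (1 + a\<^sup>2) * (m * norm (frame a b *v x))"
    by (simp add: norm_frame[OF assms(1)])
  also have "\<dots> \<le> norm (framed_diag a b \<alpha> \<beta> *v x)"
    unfolding norm_framed_diag[OF assms(1)] using norm_diag_ge[OF assms(2-4)]
    by (intro mult_left_mono) auto
  finally show ?thesis .
qed

lemma norm_framed_diag_le:
  assumes "cmod b = 1" "cmod \<alpha> \<le> m" "cmod \<beta> \<le> m"
  shows "norm (framed_diag a b \<alpha> \<beta> *v x) \<le> (1 + a\<^sup>2) * m * norm x"
proof -
  have "norm (framed_diag a b \<alpha> \<beta> *v x) \<le> sqrt (1 + a\<^sup>2) * (m * norm (frame a b *v x))"
    unfolding norm_framed_diag[OF assms(1)] using norm_diag_le[OF assms(2-3)]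
    by (intro mult_left_mono) auto
  also have "\<dots> = sqrt (1 + a\<^sup>2) * (m * (sqrt (1 + a\<^sup>2) * norm x))"
    by (simp add: norm_frame[OF assms(1)])
  also have "\<dots> = (1 + a\<^sup>2) * m * norm x"
    by simp
  finally show ?thesis .
qed

lemma op_norm_framed_diag:
  assumes "cmod b = 1" "cmod \<beta> \<le> cmod \<alpha>"
  shows "op_norm (framed_diag a b \<alpha> \<beta>) \<le> (1 + a\<^sup>2) * cmod \<alpha>"
  using assms by (intro op_norm_le norm_framed_diag_le) auto

lemma singular_value_framed_diag_ge:
  assumes "cmod b = 1" "cmod \<alpha> = 1"
  shows "(1 + a\<^sup>2) * min 1 (cmod \<beta>) \<le> singular_value 1 (framed_diag a b \<alpha> \<beta>)"
  using assms by (intro singular_value_ge norm_framed_diag_ge) auto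

text \<open>Replacing \<open>\<beta>\<close> by zero leaves a matrix of rank at most one, all of whose rows are multiples of
  the first row of \<open>frame a b\<close>.\<close>

lemma singular_value_framed_diag_le:
  assumes b: "cmod b = 1"
  shows "singular_value 1 (framed_diag a b \<alpha> \<beta>) \<le> (1 + a\<^sup>2) * cmod \<beta>"
proof -
  let ?K = "framed_diag a b \<alpha> 0" and ?r = "vector [1 / b, of_real a] :: complex^2"
  have nz: "b \<noteq> 0" using b by auto
  have row: "row 1 ?K = (\<alpha> / b) *s ?r" "row 2 ?K = (- of_real a * \<alpha>) *s ?r"
    using nz by (auto simp: vec2_eq_iff row_def framed_diag_nth[OF nz] power2_eq_square)
  have "row i ?K \<in> vec.span {?r}" for i
    using exhaust_2[of i] row vec.span_scale[OF vec.span_base[OF insertI1]] by metis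
  then have "rows ?K \<subseteq> vec.span {?r}"
    unfolding rows_def by blast
  then have "rank ?K \<le> card {?r}"
    unfolding row_rank_def_gen by (intro vec.dim_le_card) auto
  then have "rank ?K \<le> 1" by simp
  then have "singular_value 1 (framed_diag a b \<alpha> \<beta>) \<le> op_norm (framed_diag a b \<alpha> \<beta> - ?K)"
    by (rule singular_value_le)
  also have "framed_diag a b \<alpha> \<beta> - ?K = framed_diag a b 0 \<beta>"
    by (simp add: mat2_eq_iff framed_diag_nth[OF nz] algebra_simps)
  also have "op_norm (framed_diag a b 0 \<beta>) \<le> (1 + a\<^sup>2) * cmod \<beta>"
    using b by (intro op_norm_le norm_framed_diag_le) auto
  finally show ?thesis .
qed

section \<open>Best approximation by bounded analytic functions\<close>

text \<open>If \<open>x\<close> is a maximal vector of \<open>\<Psi>\<close> at every point and \<open>\<Psi> x\<close> is orthogonal to the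
  analytic functions, then an optimal error \<open>\<Psi> - F\<close> has to agree with \<open>\<Psi>\<close> on \<open>x\<close>.\<close>

lemma extremal_vector_annihilated:
  fixes \<Psi> F :: "complex \<Rightarrow> complex^'n^'m" and x :: "complex \<Rightarrow> complex^'n"
  assumes F: "\<And>i j. \<exists>G. boundary_function G (\<lambda>\<zeta>. F \<zeta> $ i $ j)"
    and x: "\<And>j. (\<lambda>\<zeta>. x \<zeta> $ j) analytic_on cball 0 1"
    and g: "\<And>i. \<exists>g. g analytic_on cball 0 1 \<and> (\<forall>\<zeta>\<in>sphere 0 1. cnj ((\<Psi> \<zeta> *v x \<zeta>) $ i) = \<zeta> * g \<zeta>)"
    and max: "\<And>\<zeta>. \<zeta> \<in> sphere 0 1 \<Longrightarrow> norm (\<Psi> \<zeta> *v x \<zeta>) = c * norm (x \<zeta>)"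
    and le: "AE \<zeta> in circle. op_norm (\<Psi> \<zeta> - F \<zeta>) \<le> c"
  shows "AE \<zeta> in circle. F \<zeta> *v x \<zeta> = 0"
proof -
  obtain G where G: "\<And>i j. boundary_function (G i j) (\<lambda>\<zeta>. F \<zeta> $ i $ j)"
    using F by metis
  obtain h where h: "\<And>i. h i analytic_on cball 0 1"
      "\<And>i \<zeta>. \<zeta> \<in> sphere 0 1 \<Longrightarrow> cnj ((\<Psi> \<zeta> *v x \<zeta>) $ i) = \<zeta> * h i \<zeta>"
    using g by metis
  have norm2: "(norm v)\<^sup>2 = (\<Sum>i\<in>UNIV. (cmod (v $ i))\<^sup>2)" for v :: "complex^'m"
    by (simp add: norm_vec_def L2_set_def sum_nonneg)
  have bf: "boundary_function (\<lambda>\<zeta>. \<Sum>j\<in>UNIV. G i j \<zeta> * x \<zeta> $ j) (\<lambda>\<zeta>. (F \<zeta> *v x \<zeta>) $ i)" for i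
    unfolding matrix_vector_mult_def vec_lambda_beta
    by (intro boundary_function_sum boundary_function_mult boundary_function_analytic G x)
  have "AE \<zeta> in circle. \<forall>i\<in>UNIV. (F \<zeta> *v x \<zeta>) $ i = 0"
  proof (rule error_orthogonal_vanishes[where g = h])
    show "AE \<zeta> in circle. (\<Sum>i\<in>UNIV. (cmod ((\<Psi> \<zeta> *v x \<zeta>) $ i - (F \<zeta> *v x \<zeta>) $ i))\<^sup>2)
        \<le> (\<Sum>i\<in>UNIV. (cmod ((\<Psi> \<zeta> *v x \<zeta>) $ i))\<^sup>2)"
      using le AE_space
    proof eventually_elim
      case (elim \<zeta>)
      have "norm (\<Psi> \<zeta> *v x \<zeta> - F \<zeta> *v x \<zeta>) \<le> op_norm (\<Psi> \<zeta> - F \<zeta>) * norm (x \<zeta>)"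
        using norm_matrix_vector_le[of "\<Psi> \<zeta> - F \<zeta>" "x \<zeta>"]
        by (simp add: matrix_vector_mult_diff_rdistrib)
      also have "\<dots> \<le> norm (\<Psi> \<zeta> *v x \<zeta>)"
        using elim by (simp add: max mult_right_mono)
      finally have "(norm (\<Psi> \<zeta> *v x \<zeta> - F \<zeta> *v x \<zeta>))\<^sup>2 \<le> (norm (\<Psi> \<zeta> *v x \<zeta>))\<^sup>2"
        by (simp add: power_mono)
      then show ?case
        unfolding norm2 by simp
    qed
  qed (use bf h in auto)
  then show ?thesis
    by eventually_elim (simp add: vec_eq_iff)
qed

lemma Hinf_entry_boundary_function:
  assumes "F \<in> Hinf"
  shows "\<exists>G. boundary_function G (\<lambda>\<zeta>. F \<zeta> $ i $ j)"
proof -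
  obtain G where G: "bounded_analytic_on_disk G"
      "AE \<zeta> in circle. ((\<lambda>r. G (of_real r * \<zeta>)) \<longlongrightarrow> F \<zeta>) (at_left 1)"
    and F: "F \<in> borel_measurable circle"
    using assms by (auto simp: Hinf_def Linf_def)
  have "(\<lambda>\<zeta>. F \<zeta> $ i $ j) \<in> borel_measurable circle"
    by (rule borel_measurable_continuous_on[OF _ F, where f = "\<lambda>A. A $ i $ j"])
       (auto intro!: continuous_intros)
  moreover have "AE \<zeta> in circle. ((\<lambda>r. G (of_real r * \<zeta>) $ i $ j) \<longlongrightarrow> F \<zeta> $ i $ j) (at_left 1)"
    using G(2) by eventually_elim (intro tendsto_vec_nth)
  moreover have "bounded ((\<lambda>z. G z $ i $ j) ` ball 0 1)"
  proof -
    obtain C where "\<And>z. z \<in> ball 0 1 \<Longrightarrow> norm (G z) \<le> C"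
      using G(1) unfolding bounded_analytic_on_disk_def bounded_iff by blast
    then have "norm (G z $ i $ j) \<le> C" if "z \<in> ball 0 1" for z
      using Finite_Cartesian_Product.norm_nth_le[of "G z $ i" j]
        Finite_Cartesian_Product.norm_nth_le[of "G z" i] that by force
    then show ?thesis unfolding bounded_iff by blast
  qed
  ultimately show ?thesis
    using G(1) unfolding boundary_function_def bounded_analytic_on_disk_def by blast
qed

lemma analytic_entries_continuous:
  fixes F :: "complex \<Rightarrow> complex^'n^'m"
  assumes "\<And>i j. (\<lambda>z. F z $ i $ j) analytic_on S"
  shows "continuous_on S F"
proof -
  have "continuous_on S (\<lambda>z. F z $ i $ j)" for i j
    using assms by (intro holomorphic_on_imp_continuous_on analytic_imp_holomorphic)
  then have "continuous_on S (\<lambda>z. \<chi> i j. F z $ i $ j)"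
    by (intro continuous_on_vec_lambda)
  then show ?thesis by simp
qed

lemma analytic_entries_bounded_analytic:
  fixes F :: "complex \<Rightarrow> complex^'n^'m"
  assumes "\<And>i j. (\<lambda>z. F z $ i $ j) analytic_on cball 0 1"
  shows "bounded_analytic_on_disk F"
proof -
  have "bounded (F ` cball 0 1)"
    using analytic_entries_continuous[OF assms]
    by (intro compact_imp_bounded compact_continuous_image) auto
  then have "bounded (F ` ball 0 1)"
    by (rule bounded_subset) auto
  moreover have "(\<lambda>z. F z $ i $ j) holomorphic_on ball 0 1" for i j
    using analytic_imp_holomorphic[OF assms] holomorphic_on_subset ball_subset_cball by blast
  ultimately show ?thesis
    by (simp add: bounded_analytic_on_disk_def)
qed

lemma analytic_imp_Hinf:
  fixes F :: "complex \<Rightarrow> complex^'n^'m"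
  assumes "\<And>i j. (\<lambda>z. F z $ i $ j) analytic_on cball 0 1"
  shows "F \<in> Hinf"
proof -
  have bf: "boundary_function (\<lambda>z. F z $ i $ j) (\<lambda>z. F z $ i $ j)" for i j
    using assms by (rule boundary_function_analytic)
  have cont: "continuous_on (cball 0 1) F"
    using assms by (rule analytic_entries_continuous)
  have cont_s: "continuous_on (sphere 0 1) F"
    by (rule continuous_on_subset[OF cont]) auto
  obtain C where C: "\<And>z. z \<in> sphere 0 1 \<Longrightarrow> op_norm (F z) \<le> C"
  proof -
    have "bounded ((\<lambda>z. op_norm (F z)) ` sphere 0 1)"
      by (intro compact_imp_bounded compact_continuous_image continuous_on_op_norm cont_s) simp
    then show ?thesis using that unfolding bounded_iff by (metis abs_le_D1 imageI real_norm_def)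
  qed
  have "(\<lambda>\<zeta>. op_norm (F \<zeta>)) \<in> borel_measurable circle"
    by (intro borel_measurable_circle_continuous continuous_on_op_norm cont_s)
  then have "esssup circle (\<lambda>\<zeta>. ereal (op_norm (F \<zeta>))) \<le> ereal C"
    by (intro esssup_I borel_measurable_ereal AE_I2) (auto intro: C)
  then have "F \<in> Linf"
    using borel_measurable_circle_continuous[OF cont_s] by (auto simp: Linf_def)
  moreover have "bounded_analytic_on_disk F"
    using assms by (rule analytic_entries_bounded_analytic)
  moreover have "AE \<zeta> in circle. ((\<lambda>r. F (of_real r * \<zeta>)) \<longlongrightarrow> F \<zeta>) (at_left 1)"
  proof -
    have "AE \<zeta> in circle. \<forall>i j. ((\<lambda>r. F (of_real r * \<zeta>) $ i $ j) \<longlongrightarrow> F \<zeta> $ i $ j) (at_left 1)"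
      using boundary_function_limit[OF bf] by (simp add: AE_all_countable)
    then show ?thesis
      by eventually_elim (auto intro!: vec_tendstoI)
  qed
  ultimately show ?thesis by (auto simp: Hinf_def)
qed

lemma esssup_const_on:
  assumes "\<And>x. x \<in> space M \<Longrightarrow> f x = (c :: ereal)"
  shows "esssup M f \<le> c"
proof (rule esssup_I)
  show "f \<in> borel_measurable M"
    using measurable_cong[of M f "\<lambda>_. c" borel] assms by simp
qed (use assms in auto)

section \<open>The superoptimal approximant\<close>

text \<open>On the circle these are the conjugates of analytic functions vanishing at the origin.\<close>

definition antianalytic :: "(complex \<Rightarrow> complex) \<Rightarrow> bool" where
  "antianalytic f \<longleftrightarrow> (\<exists>g. g analytic_on cball 0 1 \<and> (\<forall>\<zeta>\<in>sphere 0 1. cnj (f \<zeta>) = \<zeta> * g \<zeta>))"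

lemma antianalytic_cmult:
  assumes "antianalytic f" "\<And>\<zeta>. \<zeta> \<in> sphere 0 1 \<Longrightarrow> h \<zeta> = c * f \<zeta>"
  shows "antianalytic h"
proof -
  obtain g where "g analytic_on cball 0 1" "\<forall>\<zeta>\<in>sphere 0 1. cnj (f \<zeta>) = \<zeta> * g \<zeta>"
    using assms(1) unfolding antianalytic_def by blast
  then show ?thesis
    unfolding antianalytic_def
    by (intro exI[of _ "\<lambda>z. cnj c * g z"]) (auto intro!: analytic_intros simp: assms(2))
qed

text \<open>The abstract situation in which zero is superoptimal: \<open>p\<close> and \<open>q\<close> are analytic functions
  without zeros on the circle which make the relevant multiples of \<open>1/b1\<close>, \<open>b0/b1\<close> and
  \<open>b2/b0\<close> antianalytic. They express that the two diagonal entries have negative winding number.\<close>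

locale extremal_symbol =
  fixes a t :: real and b0 b1 b2 p q :: "complex \<Rightarrow> complex" and \<Psi> :: "complex \<Rightarrow> complex^2^2"
  assumes a_pos: "0 < a" and t_pos: "0 < t" and t_less: "t < 1"
    and unimodular: "\<And>\<zeta>. \<zeta> \<in> sphere 0 1 \<Longrightarrow> cmod (b0 \<zeta>) = 1"
      "\<And>\<zeta>. \<zeta> \<in> sphere 0 1 \<Longrightarrow> cmod (b1 \<zeta>) = 1" "\<And>\<zeta>. \<zeta> \<in> sphere 0 1 \<Longrightarrow> cmod (b2 \<zeta>) = 1"
    and analytic: "b0 analytic_on cball 0 1" "p analytic_on cball 0 1" "q analytic_on cball 0 1"
    and nonzero: "\<And>\<zeta>. \<zeta> \<in> sphere 0 1 \<Longrightarrow> p \<zeta> \<noteq> 0" "\<And>\<zeta>. \<zeta> \<in> sphere 0 1 \<Longrightarrow> q \<zeta> \<noteq> 0"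
    and antianalytic: "antianalytic (\<lambda>\<zeta>. p \<zeta> / b1 \<zeta>)" "antianalytic (\<lambda>\<zeta>. p \<zeta> * b0 \<zeta> / b1 \<zeta>)"
      "antianalytic (\<lambda>\<zeta>. q \<zeta> * b2 \<zeta> / b0 \<zeta>)"
    and \<Psi>: "\<And>\<zeta>. \<zeta> \<in> sphere 0 1 \<Longrightarrow>
        \<Psi> \<zeta> = framed_diag a (b0 \<zeta>) (b0 \<zeta> / b1 \<zeta>) (of_real t * (b2 \<zeta> / b0 \<zeta>))"
begin

lemma nz: "b0 \<zeta> \<noteq> 0" "b1 \<zeta> \<noteq> 0" "b2 \<zeta> \<noteq> 0" if "\<zeta> \<in> sphere 0 1"
  using unimodular[OF that] by auto

lemma diag_norm:
  assumes "\<zeta> \<in> sphere 0 1"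
  shows "cmod (b0 \<zeta> / b1 \<zeta>) = 1" "cmod (of_real t * (b2 \<zeta> / b0 \<zeta>)) = t"
  using unimodular[OF assms] t_pos by (simp_all add: norm_divide norm_mult)

text \<open>The maximal vectors: \<open>(b0, a)\<close> is mapped by \<open>frame a b0\<close> to a multiple of the first unit
  vector, and so is \<open>(b0, - a)\<close> by its transpose. The factor \<open>p\<close> makes their images antianalytic.\<close>

definition x_right :: "complex \<Rightarrow> complex^2" where
  "x_right \<zeta> = vector [p \<zeta> * b0 \<zeta>, p \<zeta> * of_real a]"

definition x_left :: "complex \<Rightarrow> complex^2" where
  "x_left \<zeta> = vector [p \<zeta> * b0 \<zeta>, - p \<zeta> * of_real a]"

lemma \<Psi>_x_right:
  assumes "\<zeta> \<in> sphere 0 1"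
  shows "(\<Psi> \<zeta> *v x_right \<zeta>) $ 1 = of_real (1 + a\<^sup>2) * (p \<zeta> / b1 \<zeta>)"
    "(\<Psi> \<zeta> *v x_right \<zeta>) $ 2 = - of_real (a * (1 + a\<^sup>2)) * (p \<zeta> * b0 \<zeta> / b1 \<zeta>)"
  using nz[OF assms]
  by (simp_all add: \<Psi>[OF assms] matrix_vector_mult_2_nth framed_diag_nth x_right_def power2_eq_square
      field_simps)

lemma \<Psi>_x_left:
  assumes "\<zeta> \<in> sphere 0 1"
  shows "(transpose (\<Psi> \<zeta>) *v x_left \<zeta>) $ 1 = of_real (1 + a\<^sup>2) * (p \<zeta> / b1 \<zeta>)"
    "(transpose (\<Psi> \<zeta>) *v x_left \<zeta>) $ 2 = of_real (a * (1 + a\<^sup>2)) * (p \<zeta> * b0 \<zeta> / b1 \<zeta>)"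
  using nz[OF assms]
  by (simp_all add: \<Psi>[OF assms] matrix_vector_mult_2_nth framed_diag_nth x_left_def transpose_def
      power2_eq_square field_simps)

text \<open>Both maximal vectors have components of absolute values \<open>|p|\<close> and \<open>a |p|\<close>, and their
  images have components of absolute values \<open>(1 + a\<^sup>2) |p|\<close> and \<open>a (1 + a\<^sup>2) |p|\<close>.\<close>

lemma norm_vector_pair:
  assumes "\<zeta> \<in> sphere 0 1" "cmod u = cmod (p \<zeta>)" "cmod v = a * cmod (p \<zeta>)"
    "v' = of_real (1 + a\<^sup>2) * (p \<zeta> / b1 \<zeta>)"
    "cmod w' = a * (1 + a\<^sup>2) * cmod (p \<zeta>)"
  shows "norm (vector [v', w'] :: complex^2) = (1 + a\<^sup>2) * norm (vector [u, v] :: complex^2)"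
proof (rule power2_eq_imp_eq)
  have "cmod v' = (1 + a\<^sup>2) * cmod (p \<zeta>)"
    using unimodular[OF assms(1)] abs_of_nonneg[of "1 + a\<^sup>2"]
    by (simp add: assms(4) norm_mult norm_divide del: of_real_add of_real_power)
  then have "(norm (vector [v', w'] :: complex^2))\<^sup>2 = ((1 + a\<^sup>2) * cmod (p \<zeta>))\<^sup>2 + (a * (1 + a\<^sup>2) * cmod (p \<zeta>))\<^sup>2"
    by (simp only: norm_vec2 vector_2 assms(5))
  also have "\<dots> = (1 + a\<^sup>2)\<^sup>2 * ((cmod (p \<zeta>))\<^sup>2 + (a * cmod (p \<zeta>))\<^sup>2)"
    by (simp add: power2_eq_square algebra_simps)
  also have "\<dots> = ((1 + a\<^sup>2) * norm (vector [u, v] :: complex^2))\<^sup>2"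
    by (simp only: norm_vec2 vector_2 assms(2,3) power_mult_distrib)
  finally show "(norm (vector [v', w'] :: complex^2))\<^sup>2 = ((1 + a\<^sup>2) * norm (vector [u, v] :: complex^2))\<^sup>2" .
qed auto

lemma norm_\<Psi>_x_right:
  assumes "\<zeta> \<in> sphere 0 1"
  shows "norm (\<Psi> \<zeta> *v x_right \<zeta>) = (1 + a\<^sup>2) * norm (x_right \<zeta>)"
  unfolding x_right_def[of \<zeta>]
  by (subst vec2_vector, rule norm_vector_pair[OF assms])
     (use unimodular[OF assms] a_pos \<Psi>_x_right[OF assms] abs_of_nonneg[of "1 + a\<^sup>2"] in
       \<open>simp_all add: norm_mult norm_divide abs_mult x_right_def del: of_real_add of_real_power\<close>)

lemma norm_\<Psi>_x_left:
  assumes "\<zeta> \<in> sphere 0 1"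
  shows "norm (transpose (\<Psi> \<zeta>) *v x_left \<zeta>) = (1 + a\<^sup>2) * norm (x_left \<zeta>)"
  unfolding x_left_def[of \<zeta>]
  by (subst vec2_vector, rule norm_vector_pair[OF assms])
     (use unimodular[OF assms] a_pos \<Psi>_x_left[OF assms] abs_of_nonneg[of "1 + a\<^sup>2"] in
       \<open>simp_all add: norm_mult norm_divide abs_mult x_left_def del: of_real_add of_real_power\<close>)

context
  fixes F :: "complex \<Rightarrow> complex^2^2"
  assumes F: "\<And>i j. \<exists>G. boundary_function G (\<lambda>\<zeta>. F \<zeta> $ i $ j)"
    and F_le: "AE \<zeta> in circle. op_norm (\<Psi> \<zeta> - F \<zeta>) \<le> 1 + a\<^sup>2"
begin

lemma F_x_right: "AE \<zeta> in circle. F \<zeta> *v x_right \<zeta> = 0"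
proof (rule extremal_vector_annihilated[OF F _ _ norm_\<Psi>_x_right F_le])
  show "(\<lambda>\<zeta>. x_right \<zeta> $ j) analytic_on cball 0 1" for j
    using exhaust_2[of j] by (auto simp: x_right_def intro!: analytic_intros analytic)
  have "antianalytic (\<lambda>\<zeta>. (\<Psi> \<zeta> *v x_right \<zeta>) $ 1)" "antianalytic (\<lambda>\<zeta>. (\<Psi> \<zeta> *v x_right \<zeta>) $ 2)"
    by (rule antianalytic_cmult[OF antianalytic(1) \<Psi>_x_right(1)], assumption,
        rule antianalytic_cmult[OF antianalytic(2) \<Psi>_x_right(2)], assumption)
  then show "\<exists>g. g analytic_on cball 0 1 \<and> (\<forall>\<zeta>\<in>sphere 0 1. cnj ((\<Psi> \<zeta> *v x_right \<zeta>) $ i) = \<zeta> * g \<zeta>)" for i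
    unfolding antianalytic_def using exhaust_2[of i] by auto
qed

lemma F_x_left: "AE \<zeta> in circle. transpose (F \<zeta>) *v x_left \<zeta> = 0"
proof (rule extremal_vector_annihilated[OF _ _ _ norm_\<Psi>_x_left])
  show "\<exists>G. boundary_function G (\<lambda>\<zeta>. transpose (F \<zeta>) $ i $ j)" for i j
    using F by (simp add: transpose_def)
  show "(\<lambda>\<zeta>. x_left \<zeta> $ j) analytic_on cball 0 1" for j
    using exhaust_2[of j] by (auto simp: x_left_def intro!: analytic_intros analytic)
  have "antianalytic (\<lambda>\<zeta>. (transpose (\<Psi> \<zeta>) *v x_left \<zeta>) $ 1)"
    "antianalytic (\<lambda>\<zeta>. (transpose (\<Psi> \<zeta>) *v x_left \<zeta>) $ 2)"
    by (rule antianalytic_cmult[OF antianalytic(1) \<Psi>_x_left(1)], assumption,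
        rule antianalytic_cmult[OF antianalytic(2) \<Psi>_x_left(2)], assumption)
  then show "\<exists>g. g analytic_on cball 0 1 \<and>
      (\<forall>\<zeta>\<in>sphere 0 1. cnj ((transpose (\<Psi> \<zeta>) *v x_left \<zeta>) $ i) = \<zeta> * g \<zeta>)" for i
    unfolding antianalytic_def using exhaust_2[of i] by auto
  have "transpose A - transpose B = transpose (A - B)" for A B :: "complex^2^2"
    by (simp add: transpose_def vec_eq_iff)
  then show "AE \<zeta> in circle. op_norm (transpose (\<Psi> \<zeta>) - transpose (F \<zeta>)) \<le> 1 + a\<^sup>2"
    using F_le by (auto elim!: eventually_mono intro: order_trans[OF op_norm_transpose_le])
qed

lemma op_norm_error_ge: "AE \<zeta> in circle. 1 + a\<^sup>2 \<le> op_norm (\<Psi> \<zeta> - F \<zeta>)"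
  using F_x_right AE_space
proof eventually_elim
  case (elim \<zeta>)
  then have z: "\<zeta> \<in> sphere 0 1" by simp
  have "x_right \<zeta> \<noteq> 0"
    using nz[OF z] nonzero[OF z] by (simp add: vec2_eq_iff x_right_def)
  then show ?case
    using elim norm_\<Psi>_x_right[OF z]
    by (intro op_norm_ge[of "x_right \<zeta>"]) (auto simp: matrix_vector_mult_diff_rdistrib)
qed

text \<open>The column condition \<open>F x_right = 0\<close> and the row condition \<open>transpose F x_left = 0\<close>
  determine \<open>F\<close> by its first entry.\<close>

lemma F_structure: "AE \<zeta> in circle. F \<zeta> = framed_diag a (b0 \<zeta>) 0 (- (F \<zeta> $ 1 $ 1 / (of_real a)\<^sup>2))"
  using F_x_right F_x_left AE_space
proof eventually_elim
  case (elim \<zeta>)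
  then have z: "\<zeta> \<in> sphere 0 1" by simp
  note nz = nz[OF z] nonzero[OF z] a_pos
  have r: "p \<zeta> * (F \<zeta> $ 1 $ 1 * b0 \<zeta> + of_real a * F \<zeta> $ 1 $ 2) = 0"
    and l: "p \<zeta> * (F \<zeta> $ 1 $ 1 * b0 \<zeta> - of_real a * F \<zeta> $ 2 $ 1) = 0"
      "p \<zeta> * (F \<zeta> $ 1 $ 2 * b0 \<zeta> - of_real a * F \<zeta> $ 2 $ 2) = 0"
    using elim(1,2)
    by (simp_all add: vec2_eq_iff matrix_vector_mult_2_nth x_right_def x_left_def transpose_def
        algebra_simps)
  have 12: "F \<zeta> $ 1 $ 2 = - (F \<zeta> $ 1 $ 1 * b0 \<zeta> / of_real a)"
  proof -
    have "F \<zeta> $ 1 $ 1 * b0 \<zeta> + of_real a * F \<zeta> $ 1 $ 2 = 0" using r nz by simp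
    then show ?thesis using nz by (simp add: eq_neg_iff_add_eq_0 field_simps)
  qed
  moreover note 12
  moreover have "F \<zeta> $ 2 $ 1 = F \<zeta> $ 1 $ 1 * b0 \<zeta> / of_real a"
  proof -
    have "F \<zeta> $ 1 $ 1 * b0 \<zeta> - of_real a * F \<zeta> $ 2 $ 1 = 0" using l(1) nz by simp
    then show ?thesis using nz by (simp add: field_simps)
  qed
  moreover have "F \<zeta> $ 2 $ 2 = - (F \<zeta> $ 1 $ 1 * b0 \<zeta> / of_real a) * b0 \<zeta> / of_real a"
  proof -
    have "F \<zeta> $ 1 $ 2 * b0 \<zeta> - of_real a * F \<zeta> $ 2 $ 2 = 0" using l(2) nz by simp
    then have "F \<zeta> $ 2 $ 2 = F \<zeta> $ 1 $ 2 * b0 \<zeta> / of_real a" using nz by (simp add: field_simps)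
    then show ?thesis unfolding 12 .
  qed
  ultimately show ?case
    using nz by (simp add: mat2_eq_iff framed_diag_nth power2_eq_square field_simps)
qed

text \<open>By the structure of \<open>F\<close>, the error is \<open>frame * diag (b0/b1, t b2/b0 + f) * frame\<close>. Its
  second singular value bounds \<open>min 1 |t b2/b0 + f|\<close>, and \<open>t < 1\<close> excludes the value one. So
  adding the analytic function \<open>f q\<close> to the antianalytic function \<open>q t b2/b0\<close> increases the absolute
  value nowhere, which is possible only for \<open>f = 0\<close>.\<close>

lemma superoptimal_error_unique:
  assumes s: "AE \<zeta> in circle. singular_value 1 (\<Psi> \<zeta> - F \<zeta>) \<le> (1 + a\<^sup>2) * t"
  shows "AE \<zeta> in circle. F \<zeta> = 0"
proof -
  define f where "f \<zeta> = F \<zeta> $ 1 $ 1 / (of_real a)\<^sup>2" for \<zeta>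
  obtain G where G: "boundary_function G (\<lambda>\<zeta>. F \<zeta> $ 1 $ 1)"
    using F by blast
  obtain g where g: "g analytic_on cball 0 1"
      "\<forall>\<zeta>\<in>sphere 0 1. cnj (of_real t * (q \<zeta> * b2 \<zeta> / b0 \<zeta>)) = \<zeta> * g \<zeta>"
    using antianalytic_cmult[OF antianalytic(3), of "\<lambda>\<zeta>. of_real t * (q \<zeta> * b2 \<zeta> / b0 \<zeta>)" "of_real t"]
    unfolding antianalytic_def by blast
  have "boundary_function (\<lambda>\<zeta>. G \<zeta> * (- q \<zeta> / (of_real a)\<^sup>2))
      (\<lambda>\<zeta>. F \<zeta> $ 1 $ 1 * (- q \<zeta> / (of_real a)\<^sup>2))"
    using a_pos
    by (intro boundary_function_mult G boundary_function_analytic analytic_intros analytic) auto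
  then have bf: "boundary_function (\<lambda>\<zeta>. G \<zeta> * (- q \<zeta> / (of_real a)\<^sup>2)) (\<lambda>\<zeta>. - f \<zeta> * q \<zeta>)"
    by (simp add: f_def)
  have "AE \<zeta> in circle. \<forall>i\<in>{()}. - f \<zeta> * q \<zeta> = 0"
  proof (rule error_orthogonal_vanishes[where y = "\<lambda>_ \<zeta>. of_real t * (q \<zeta> * b2 \<zeta> / b0 \<zeta>)"])
    show "AE \<zeta> in circle. (\<Sum>i\<in>{()}. (cmod (of_real t * (q \<zeta> * b2 \<zeta> / b0 \<zeta>) - - f \<zeta> * q \<zeta>))\<^sup>2)
         \<le> (\<Sum>i\<in>{()}. (cmod (of_real t * (q \<zeta> * b2 \<zeta> / b0 \<zeta>)))\<^sup>2)"
      using F_structure s AE_space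
    proof eventually_elim
      case (elim \<zeta>)
      then have z: "\<zeta> \<in> sphere 0 1" by simp
      define \<beta> where "\<beta> = of_real t * (b2 \<zeta> / b0 \<zeta>) + f \<zeta>"
      have "\<Psi> \<zeta> - F \<zeta> = framed_diag a (b0 \<zeta>) (b0 \<zeta> / b1 \<zeta>) \<beta>"
        by (subst elim(1)) (simp add: \<Psi>[OF z] framed_diag_diff[OF nz(1)[OF z]] f_def \<beta>_def)
      then have "(1 + a\<^sup>2) * min 1 (cmod \<beta>) \<le> (1 + a\<^sup>2) * t"
        using elim(2) singular_value_framed_diag_ge[OF unimodular(1)[OF z] diag_norm(1)[OF z], of a \<beta>] by simp
      moreover have "0 < 1 + a\<^sup>2"
        by (simp add: add_pos_nonneg)
      ultimately have "min 1 (cmod \<beta>) \<le> t"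
        by simp
      then have \<beta>: "cmod \<beta> \<le> t"
        using t_less by (simp add: min_def split: if_splits)
      have "of_real t * (q \<zeta> * b2 \<zeta> / b0 \<zeta>) - - f \<zeta> * q \<zeta> = q \<zeta> * \<beta>"
        by (simp add: \<beta>_def algebra_simps)
      moreover have "cmod (of_real t * (q \<zeta> * b2 \<zeta> / b0 \<zeta>)) = cmod (q \<zeta>) * t"
        using unimodular[OF z] t_pos by (simp add: norm_mult norm_divide)
      ultimately show ?case
        using \<beta> by (simp add: norm_mult power_mono mult_left_mono)
    qed
  qed (use bf g in auto)
  with F_structure AE_space show ?thesis
  proof eventually_elim
    case (elim \<zeta>)
    then have z: "\<zeta> \<in> sphere 0 1" by simp
    have "f \<zeta> = 0"
      using elim(3) nonzero[OF z] by simp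
    then show ?case
      by (subst elim(1)) (use nz[OF z] a_pos in \<open>simp add: f_def mat2_eq_iff framed_diag_nth\<close>)
  qed
qed

end

lemma op_norm_\<Psi>:
  assumes z: "\<zeta> \<in> sphere 0 1"
  shows "op_norm (\<Psi> \<zeta>) = 1 + a\<^sup>2"
proof (rule antisym)
  show "op_norm (\<Psi> \<zeta>) \<le> 1 + a\<^sup>2"
    using op_norm_framed_diag[OF unimodular(1)[OF z], of "of_real t * (b2 \<zeta> / b0 \<zeta>)" "b0 \<zeta> / b1 \<zeta>" a] diag_norm[OF z] t_less
    by (simp add: \<Psi>[OF z])
  have "x_right \<zeta> \<noteq> 0"
    using nz[OF z] nonzero[OF z] by (simp add: vec2_eq_iff x_right_def)
  then show "1 + a\<^sup>2 \<le> op_norm (\<Psi> \<zeta>)"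
    using norm_\<Psi>_x_right[OF z] by (intro op_norm_ge) auto
qed

lemma singular_value_\<Psi>:
  assumes z: "\<zeta> \<in> sphere 0 1"
  shows "singular_value 1 (\<Psi> \<zeta>) = (1 + a\<^sup>2) * t"
  using singular_value_framed_diag_le[OF unimodular(1)[OF z], of a "b0 \<zeta> / b1 \<zeta>" "of_real t * (b2 \<zeta> / b0 \<zeta>)"]
    singular_value_framed_diag_ge[OF unimodular(1)[OF z] diag_norm(1)[OF z], of a "of_real t * (b2 \<zeta> / b0 \<zeta>)"]
    t_less
  unfolding diag_norm(2)[OF z] by (simp add: \<Psi>[OF z])

text \<open>Subtracting an analytic \<open>H\<close> from the symbol shifts all approximants by \<open>- H\<close>. The two stages
  of the minimization are compared with \<open>- H\<close>, whose error \<open>\<Psi>\<close> has constant singular values.\<close>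

theorem superoptimal_approximant:
  assumes \<Phi>: "\<And>\<zeta>. \<zeta> \<in> sphere 0 1 \<Longrightarrow> \<Phi> \<zeta> = \<Psi> \<zeta> - H \<zeta>"
    and H: "\<And>i j. (\<lambda>z. H z $ i $ j) analytic_on cball 0 1"
  shows "unique_superoptimal_approximant \<Phi> (\<lambda>z. - H z)"
proof -
  let ?E = "\<lambda>F. esssup circle (\<lambda>\<zeta>. ereal (op_norm (\<Phi> \<zeta> - F \<zeta>)))"
  let ?S = "\<lambda>F. esssup circle (\<lambda>\<zeta>. ereal (singular_value 1 (\<Phi> \<zeta> - F \<zeta>)))"
  let ?A = "\<lambda>z. - H z"
  have A: "?A \<in> Hinf"
    by (rule analytic_imp_Hinf) (auto intro!: analytic_intros H)
  have EA: "?E ?A \<le> ereal (1 + a\<^sup>2)" and SA: "?S ?A \<le> ereal ((1 + a\<^sup>2) * t)"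
    by (rule esssup_const_on; simp add: \<Phi> op_norm_\<Psi> singular_value_\<Psi> del: One_nat_def)+
  have bf: "\<exists>G. boundary_function G (\<lambda>\<zeta>. (F \<zeta> + H \<zeta>) $ i $ j)" if F: "F \<in> Hinf" for F i j
    using Hinf_entry_boundary_function[OF F] boundary_function_add
      boundary_function_analytic[OF H] by simp blast
  have E_ge: "ereal (1 + a\<^sup>2) \<le> ?E F" if F: "F \<in> Hinf" for F
  proof (rule ccontr)
    assume less: "\<not> ?thesis"
    have lt: "AE \<zeta> in circle. op_norm (\<Psi> \<zeta> - (F \<zeta> + H \<zeta>)) < 1 + a\<^sup>2"
      using esssup_AE[of "\<lambda>\<zeta>. ereal (op_norm (\<Phi> \<zeta> - F \<zeta>))" circle] AE_space
    proof eventually_elim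
      case (elim \<zeta>)
      then have "ereal (op_norm (\<Phi> \<zeta> - F \<zeta>)) < ereal (1 + a\<^sup>2)"
        using less by (meson not_le order_le_less_trans)
      then show ?case
        using elim by (simp add: \<Phi> algebra_simps del: One_nat_def)
    qed
    then have "AE \<zeta> in circle. op_norm (\<Psi> \<zeta> - (F \<zeta> + H \<zeta>)) \<le> 1 + a\<^sup>2"
      by eventually_elim simp
    from lt op_norm_error_ge[OF bf[OF F] this] have "AE \<zeta> in circle. False"
      by eventually_elim simp
    then show False by simp
  qed
  have A0: "?A \<in> Omega0 \<Phi>"
    unfolding Omega0_def is_arg_min_def using A EA E_ge by (auto simp: not_less intro: order_trans)
  have Omega0: "F \<in> Hinf" "AE \<zeta> in circle. op_norm (\<Psi> \<zeta> - (F \<zeta> + H \<zeta>)) \<le> 1 + a\<^sup>2"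
    if F: "F \<in> Omega0 \<Phi>" for F
  proof -
    show "F \<in> Hinf"
      using F by (simp add: Omega0_def is_arg_min_def)
    have "?E F \<le> ?E ?A"
      using F A unfolding Omega0_def is_arg_min_linorder mem_Collect_eq by blast
    then have le: "?E F \<le> ereal (1 + a\<^sup>2)"
      using EA by (rule order_trans)
    show "AE \<zeta> in circle. op_norm (\<Psi> \<zeta> - (F \<zeta> + H \<zeta>)) \<le> 1 + a\<^sup>2"
      using esssup_AE[of "\<lambda>\<zeta>. ereal (op_norm (\<Phi> \<zeta> - F \<zeta>))" circle] AE_space
    proof eventually_elim
      case (elim \<zeta>)
      then have "ereal (op_norm (\<Phi> \<zeta> - F \<zeta>)) \<le> ereal (1 + a\<^sup>2)"
        using le by (meson order_trans)
      then show ?case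
        using elim by (simp add: \<Phi> algebra_simps del: One_nat_def)
    qed
  qed
  have unique: "AE \<zeta> in circle. F \<zeta> = - H \<zeta>"
    if F: "F \<in> Omega0 \<Phi>" and le: "?S F \<le> ereal ((1 + a\<^sup>2) * t)" for F
  proof -
    have "AE \<zeta> in circle. singular_value 1 (\<Psi> \<zeta> - (F \<zeta> + H \<zeta>)) \<le> (1 + a\<^sup>2) * t"
      using esssup_AE[of "\<lambda>\<zeta>. ereal (singular_value 1 (\<Phi> \<zeta> - F \<zeta>))" circle] AE_space
    proof eventually_elim
      case (elim \<zeta>)
      then have "ereal (singular_value 1 (\<Phi> \<zeta> - F \<zeta>)) \<le> ereal ((1 + a\<^sup>2) * t)"
        using le by (meson order_trans)
      then show ?case
        using elim by (simp add: \<Phi> algebra_simps del: One_nat_def)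
    qed
    then have "AE \<zeta> in circle. F \<zeta> + H \<zeta> = 0"
      using superoptimal_error_unique[OF bf[OF Omega0(1)[OF F]] Omega0(2)[OF F]] by blast
    then show ?thesis
      by eventually_elim (simp add: eq_neg_iff_add_eq_0)
  qed
  have "\<not> ?S F < ?S ?A" if F: "F \<in> Omega0 \<Phi>" for F
  proof
    assume less: "?S F < ?S ?A"
    then have "?S F \<le> ereal ((1 + a\<^sup>2) * t)"
      using SA by (meson less_imp_le order_trans)
    from unique[OF F this] have "AE \<zeta> in circle. ereal ((1 + a\<^sup>2) * t) \<le> ?S F"
      using esssup_AE[of "\<lambda>\<zeta>. ereal (singular_value 1 (\<Phi> \<zeta> - F \<zeta>))" circle] AE_space
    proof eventually_elim
      case (elim \<zeta>)
      then show ?case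
        using singular_value_\<Psi>[of \<zeta>] by (simp add: \<Phi> del: One_nat_def)
    qed
    then have "ereal ((1 + a\<^sup>2) * t) \<le> ?S F" by (simp only: circle.AE_const)
    moreover have "?S F < ereal ((1 + a\<^sup>2) * t)" using less SA by (rule less_le_trans)
    ultimately show False by (meson leD)
  qed
  then have "?A \<in> Omega1 \<Phi>"
    unfolding Omega1_def is_arg_min_def using A0 by auto
  moreover have "AE \<zeta> in circle. F \<zeta> = - H \<zeta>" if "F \<in> Omega1 \<Phi>" for F
  proof (rule unique)
    show "F \<in> Omega0 \<Phi>"
      using that by (simp add: Omega1_def is_arg_min_def)
    have "?S F \<le> ?S ?A"
      using that A0 unfolding Omega1_def is_arg_min_linorder mem_Collect_eq by blast
    then show "?S F \<le> ereal ((1 + a\<^sup>2) * t)"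
      using SA by (rule order_trans)
  qed
  ultimately show ?thesis
    unfolding unique_superoptimal_approximant_def by blast
qed

end

section \<open>Blaschke products\<close>

abbreviation blaschke_list :: "complex list \<Rightarrow> complex \<Rightarrow> complex" where
  "blaschke_list ls z \<equiv> (\<Prod>w\<leftarrow>ls. blaschke_factor w z)"

lemma blaschke_denominator_nonzero:
  assumes "w \<in> ball 0 1" "z \<in> cball 0 1"
  shows "1 - cnj w * z \<noteq> 0"
proof
  assume "1 - cnj w * z = 0"
  then have "norm w * norm z = 1"
    by (metis complex_mod_cnj eq_iff_diff_eq_0 norm_mult norm_one)
  moreover have "norm w * norm z \<le> norm w * 1"
    using assms by (intro mult_left_mono) auto
  ultimately show False using assms by simp
qed

lemma blaschke_factor_eq_0_iff:
  assumes "w \<in> ball 0 1" "z \<in> cball 0 1"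
  shows "blaschke_factor w z = 0 \<longleftrightarrow> z = w"
  using blaschke_denominator_nonzero[OF assms] by (auto simp: blaschke_factor_def)

lemma blaschke_factor_analytic:
  assumes "w \<in> ball 0 1"
  shows "blaschke_factor w analytic_on cball 0 1"
  unfolding blaschke_factor_def[abs_def] using blaschke_denominator_nonzero[OF assms]
  by (intro analytic_intros) auto

lemma blaschke_list_analytic:
  assumes "set ls \<subseteq> ball 0 1"
  shows "blaschke_list ls analytic_on cball 0 1"
  using assms by (induction ls) (auto intro!: analytic_on_mult analytic_on_const blaschke_factor_analytic)

lemma blaschke_list_eq_0_iff:
  assumes "set ls \<subseteq> ball 0 1" "z \<in> cball 0 1"
  shows "blaschke_list ls z = 0 \<longleftrightarrow> z \<in> set ls"
  using assms by (induction ls) (auto simp: blaschke_factor_eq_0_iff)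

lemma analytic_continuous_on_ball:
  "f analytic_on cball 0 1 \<Longrightarrow> continuous_on (ball 0 (1::real)) f"
  by (intro holomorphic_on_imp_continuous_on holomorphic_on_subset[OF analytic_imp_holomorphic]) auto

lemma continuous_eq_off_finite:
  fixes f g :: "complex \<Rightarrow> 'a::t2_space"
  assumes "open S" "continuous_on S f" "continuous_on S g" "finite X"
    and eq: "\<And>z. z \<in> S - X \<Longrightarrow> f z = g z" and z: "z \<in> S"
  shows "f z = g z"
proof (rule tendsto_unique)
  have lim: "f \<midarrow>z\<rightarrow> f z" "g \<midarrow>z\<rightarrow> g z"
    using assms(1-3) z by (auto simp: continuous_on_eq_continuous_at isCont_def)
  have "\<forall>\<^sub>F u in at z. u \<in> S - (X - {z})"
    by (rule eventually_at_in_open') (use assms in \<open>auto intro!: open_Diff finite_imp_closed\<close>)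
  moreover have "\<forall>\<^sub>F u in at z. u \<noteq> z"
    by (auto simp: eventually_at_filter)
  ultimately have "\<forall>\<^sub>F u in at z. f u = g u"
    by eventually_elim (use eq in auto)
  then show "f \<midarrow>z\<rightarrow> g z"
    using lim(2) by (simp add: tendsto_cong)
  show "f \<midarrow>z\<rightarrow> f z" by (rule lim)
qed simp

lemma continuous_eq_off_finite_ball:
  fixes f g :: "complex \<Rightarrow> complex"
  assumes "continuous_on (ball 0 (1::real)) f" "continuous_on (ball 0 1) g" "finite X"
    and "\<And>z. z \<in> ball 0 1 - X \<Longrightarrow> f z = g z" and "z \<in> ball 0 1"
  shows "f z = g z"
  using continuous_eq_off_finite[OF open_ball assms(1,2,3)] assms(4,5) by blast

text \<open>A Blaschke product which divides \<open>m\<close> times another one, where \<open>m\<close> does not vanish at its zeros, has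
  at most the degree of the other one: its zeros can be cancelled one by one. Continuity of \<open>e\<close> carries
  the identity over to the cancelled point.\<close>

lemma blaschke_divisor_length:
  assumes "set ls \<subseteq> ball 0 1" "set ms \<subseteq> ball 0 1" "c \<noteq> 0"
    and "continuous_on (ball 0 1) m" "continuous_on (ball 0 1) e"
    and "\<And>w. w \<in> set ls \<Longrightarrow> m w \<noteq> 0"
    and "\<And>z. z \<in> ball 0 1 \<Longrightarrow> m z * (c * blaschke_list ms z) = blaschke_list ls z * e z"
  shows "length ls \<le> length ms"
  using assms
proof (induction ls arbitrary: ms)
  case (Cons w ls)
  have w: "w \<in> ball 0 1" "m w \<noteq> 0" using Cons.prems by auto
  have "m w * (c * blaschke_list ms w) = 0"
    using Cons.prems(7)[OF w(1)] by (simp add: blaschke_factor_def)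
  then have "blaschke_list ms w = 0"
    using w Cons.prems by simp
  then have "w \<in> set ms"
    using blaschke_list_eq_0_iff[OF Cons.prems(2), of w] w by simp
  then obtain xs ys where ms: "ms = xs @ w # ys"
    by (meson split_list)
  have split: "blaschke_list ms z = blaschke_factor w z * blaschke_list (xs @ ys) z" for z
    by (simp add: ms)
  have sub: "set (xs @ ys) \<subseteq> ball 0 1" "set ls \<subseteq> ball 0 1"
    using Cons.prems ms by auto
  have "length ls \<le> length (xs @ ys)"
  proof (rule Cons.IH)
    fix z :: complex assume z: "z \<in> ball 0 1"
    show "m z * (c * blaschke_list (xs @ ys) z) = blaschke_list ls z * e z"
    proof (rule continuous_eq_off_finite_ball[where X = "{w}", OF _ _ _ _ z])
      fix z assume z: "z \<in> ball 0 1 - {w}"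
      then have "blaschke_factor w z \<noteq> 0"
        using blaschke_factor_eq_0_iff[OF w(1)] by auto
      moreover have "blaschke_factor w z * (m z * (c * blaschke_list (xs @ ys) z))
          = blaschke_factor w z * (blaschke_list ls z * e z)"
        using Cons.prems(7)[of z] z by (simp add: split mult_ac)
      ultimately show "m z * (c * blaschke_list (xs @ ys) z) = blaschke_list ls z * e z"
        by (simp only: mult_cancel_left) simp
    next
      show "continuous_on (ball 0 1) (\<lambda>z. m z * (c * blaschke_list (xs @ ys) z))"
        "continuous_on (ball 0 1) (\<lambda>z. blaschke_list ls z * e z)"
        by (intro continuous_intros Cons.prems(4,5)
            analytic_continuous_on_ball[OF blaschke_list_analytic] sub)+
    qed simp
  qed (use Cons.prems(3-6) sub in simp_all)
  then show ?case by (simp add: ms)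
qed simp

lemma analytic_divide_blaschke_factor:
  assumes h: "h analytic_on cball 0 1" and w: "w \<in> ball 0 1" and "h w = 0"
  obtains k where "k analytic_on cball 0 1" "\<And>z. z \<in> cball 0 1 \<Longrightarrow> h z = blaschke_factor w z * k z"
proof
  define f where "f z = (if z = w then deriv h w else h z / (z - w))" for z
  have f: "f analytic_on cball 0 1"
    by (rule pole_theorem_analytic_0[OF h, of w]) (auto simp: f_def assms intro!: exI[of _ 1])
  show "(\<lambda>z. - (1 - cnj w * z) * f z) analytic_on cball 0 1"
    by (intro analytic_intros f)
  show "h z = blaschke_factor w z * (- (1 - cnj w * z) * f z)" if "z \<in> cball 0 1" for z
  proof (cases "z = w")
    case False
    have nz: "1 - cnj w * z \<noteq> 0"
      by (rule blaschke_denominator_nonzero[OF w that])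
    have "blaschke_factor w z * (- (1 - cnj w * z)) = z - w"
      using nonzero_mult_div_cancel_right[OF nz, of "w - z"]
      unfolding blaschke_factor_def by (simp only: mult_minus_right times_divide_eq_left) simp
    then have "blaschke_factor w z * (- (1 - cnj w * z) * f z) = (z - w) * f z"
      by (simp only: mult.assoc[symmetric])
    then show ?thesis
      using False by (simp add: f_def)
  qed (simp add: assms blaschke_factor_def)
qed

section \<open>Projections and the determinant of a Blaschke--Potapov product\<close>

lemma rank_full_iff_invertible: "rank P = 2 \<longleftrightarrow> (\<exists>Q. Q ** P = mat 1)" for P :: "'a::field^2^2"
  using vec.dim_eq_full[of "rows P"]
  by (simp add: matrix_left_invertible_span_rows_gen row_rank_def_gen vec.dimension_def card_cart_basis)

lemma rank_eq_0_iff: "rank P = 0 \<longleftrightarrow> P = 0" for P :: "'a::field^'n^'m"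
proof -
  have "rank P = 0 \<longleftrightarrow> rows P \<subseteq> {0}"
    by (simp add: row_rank_def_gen vec.dim_eq_0)
  also have "\<dots> \<longleftrightarrow> P = 0"
  proof -
    have "rows P \<subseteq> {0} \<longleftrightarrow> (\<forall>i. row i P = 0)"
      by (auto simp: rows_def)
    then show ?thesis
      by (simp add: row_def vec_eq_iff)
  qed
  finally show ?thesis .
qed

lemma rank_le_2: "rank P \<le> 2" for P :: "'a::field^2^2"
  using vec.dim_subset_UNIV[of "rows P"]
  by (simp add: row_rank_def_gen vec.dimension_def card_cart_basis)

definition trace2 :: "'a::semiring_1^2^2 \<Rightarrow> 'a" where
  "trace2 P = P $ 1 $ 1 + P $ 2 $ 2"

text \<open>By the Cayley--Hamilton theorem \<open>P = P\<^sup>2 = trace2 P * P - det P\<close>, so a projection that is neither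
  zero nor invertible has trace one.\<close>

lemma projection_cases:
  fixes P :: "'a::field^2^2"
  assumes "P ** P = P"
  obtains "P = 0" "rank P = 0" | "P = mat 1" "rank P = 2" | "det P = 0" "trace2 P = 1" "rank P = 1"
proof -
  consider "P = 0" | "\<exists>Q. Q ** P = mat 1" | "P \<noteq> 0" "\<not> (\<exists>Q. Q ** P = mat 1)" by blast
  then show thesis
  proof cases
    case 1 then show thesis using that(1) by (simp add: rank_eq_0_iff)
  next
    case 2
    then obtain Q where Q: "Q ** P = mat 1" by blast
    have "P = (Q ** P) ** P" by (simp add: Q)
    also have "\<dots> = Q ** (P ** P)" by (rule matrix_mul_assoc[symmetric])
    also have "\<dots> = mat 1" by (simp add: assms Q)
    finally show thesis using that(2) 2 rank_full_iff_invertible[of P] by simp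
  next
    case 3
    then have det: "det P = 0"
      using invertible_det_nz[of P] by (metis invertible_left_inverse)
    have "trace2 P * P $ i $ j = P $ i $ j" for i j
    proof -
      have "(P ** P) $ i $ j = trace2 P * P $ i $ j - det P * (mat 1 :: 'a^2^2) $ i $ j"
        using exhaust_2[of i] exhaust_2[of j]
        by (auto simp: matrix_mult_2_nth trace2_def det_2 mat_def algebra_simps)
      then show ?thesis by (simp add: assms det)
    qed
    moreover obtain i j where "P $ i $ j \<noteq> 0"
      using 3(1) by (auto simp: vec_eq_iff)
    ultimately have "trace2 P = 1"
      by (metis mult_cancel_right2)
    moreover have "rank P \<noteq> 0" "rank P \<noteq> 2" "rank P \<le> 2"
      using 3 rank_le_2[of P] by (simp_all add: rank_eq_0_iff rank_full_iff_invertible)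
    then have "rank P = 1" by linarith
    ultimately show thesis using that(3) det by blast
  qed
qed

lemma det_potapov_factor:
  fixes P :: "'a::field^2^2"
  assumes "P ** P = P"
  shows "det (mat b ** P + (mat 1 - P)) = b ^ rank P"
proof -
  have "det (mat b ** P + (mat 1 - P)) = 1 + (b - 1) * trace2 P + (b - 1)\<^sup>2 * det P"
    by (simp add: det_2 matrix_mult_2_nth mat_def trace2_def power2_eq_square algebra_simps)
  note formula = this
  show ?thesis
  proof (cases rule: projection_cases[OF assms])
    case 3
    then show ?thesis unfolding formula by simp
  next
    case 2
    then have "mat b ** P + (mat 1 - P) = mat b" by simp
    then show ?thesis using 2(2) by (simp add: det_2 mat_def power2_eq_square)
  qed (simp_all add: det_2 mat_def power2_eq_square)
qed

text \<open>The determinant turns the degree of a Blaschke--Potapov product into that of a scalar Blaschke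
  product, up to a constant.\<close>

lemma det_blaschke_potapov:
  fixes B :: "complex \<Rightarrow> complex^2^2"
  assumes "blaschke_potapov d B"
  obtains c ls where "c \<noteq> 0" "length ls = d" "set ls \<subseteq> ball 0 1"
    "\<And>z. det (B z) = c * blaschke_list ls z"
proof -
  have "\<exists>c ls. c \<noteq> 0 \<and> length ls = d \<and> set ls \<subseteq> ball 0 1 \<and> (\<forall>z. det (B z) = c * blaschke_list ls z)"
    using assms
  proof (induction rule: blaschke_potapov.induct)
    case (const U)
    then have "det U \<noteq> 0"
      by (metis det_I det_mul mult_zero_right unitary_matrix_def zero_neq_one)
    then show ?case by (intro exI[of _ "det U"] exI[of _ "[]"]) simp
  next
    case (factor d B w P)
    then obtain c ls where IH: "c \<noteq> 0" "length ls = d" "set ls \<subseteq> ball 0 1"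
        "\<And>z. det (B z) = c * blaschke_list ls z" by blast
    have "P ** P = P"
      using factor.hyps by (simp add: orthogonal_projection_matrix_def)
    then have "det (B z ** (mat (blaschke_factor w z) ** P + (mat 1 - P)))
        = c * blaschke_list (ls @ replicate (rank P) w) z" for z
      by (simp add: det_mul IH(4) det_potapov_factor prod_list_replicate)
    then show ?case
      using IH factor.hyps
      by (intro exI[of _ c] exI[of _ "ls @ replicate (rank P) w"]) auto
  qed
  then show thesis using that by blast
qed

lemma potapov_factor_analytic:
  assumes "w \<in> ball 0 1"
  shows "(\<lambda>z. (mat (blaschke_factor w z) ** P + (mat 1 - P) :: complex^2^2) $ i $ j) analytic_on cball 0 1"
proof -
  have "(mat (blaschke_factor w z) ** P + (mat 1 - P)) $ i $ j
      = blaschke_factor w z * P $ i $ j + (mat 1 - P) $ i $ j" for z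
    using exhaust_2[of i] by (auto simp: matrix_mult_2_nth mat_def)
  then show ?thesis
    by (simp only:) (intro analytic_intros blaschke_factor_analytic[OF assms])
qed

lemma matrix_mult_analytic:
  assumes "\<And>i j. (\<lambda>z. (A z :: complex^2^2) $ i $ j) analytic_on S"
    and "\<And>i j. (\<lambda>z. (B z :: complex^2^2) $ i $ j) analytic_on S"
  shows "(\<lambda>z. (A z ** B z) $ i $ j) analytic_on S"
  unfolding matrix_mult_2_nth by (intro analytic_intros assms)

lemma blaschke_potapov_analytic:
  fixes B :: "complex \<Rightarrow> complex^2^2"
  assumes "blaschke_potapov d B"
  shows "(\<lambda>z. B z $ i $ j) analytic_on cball 0 1"
  using assms
proof (induction arbitrary: i j rule: blaschke_potapov.induct)
  case (factor d B w P)
  show ?case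
    by (intro matrix_mult_analytic factor potapov_factor_analytic)
qed auto

section \<open>The McMillan degree\<close>

text \<open>Let \<open>b\<close> be the Blaschke product of the list \<open>ls\<close>. Since \<open>R B\<close> is analytic, \<open>b\<close> divides \<open>M B\<close>, hence also
  \<open>M B adj B = (det B) M\<close>. An entry of \<open>M\<close> that does not vanish at the zeros of \<open>b\<close> shows that \<open>b\<close>
  divides \<open>det B\<close>.\<close>

lemma disk_degree_lower_bound:
  fixes R M C G B :: "complex \<Rightarrow> complex^2^2"
  assumes ls: "set ls \<subseteq> ball 0 1"
    and M: "\<And>i j. (\<lambda>z. M z $ i $ j) analytic_on cball 0 1"
    and C: "\<And>i j. (\<lambda>z. C z $ i $ j) analytic_on cball 0 1"
    and "finite X"
    and R: "\<And>z i j. z \<in> ball 0 1 - X \<Longrightarrow>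
        blaschke_list ls z * R z $ i $ j = M z $ i $ j + blaschke_list ls z * C z $ i $ j"
    and M_nz: "\<And>w. w \<in> set ls \<Longrightarrow> M w $ k $ 2 \<noteq> 0"
    and B: "blaschke_potapov d B" and G: "bounded_analytic_on_disk G"
    and fin: "finite {z \<in> ball 0 1. G z \<noteq> R z ** B z}"
  shows "length ls \<le> d"
proof -
  obtain c ms where ms: "c \<noteq> 0" "length ms = d" "set ms \<subseteq> ball 0 1"
    "\<And>z. det (B z) = c * blaschke_list ms z"
    using det_blaschke_potapov[OF B] by blast
  \<comment> \<open>the identities below hold off this finite set and extend to the disk by continuity\<close>
  let ?Y = "X \<union> {z \<in> ball 0 1. G z \<noteq> R z ** B z}"
  let ?b = "blaschke_list ls"
  define D where "D z = G z - C z ** B z" for z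
  \<comment> \<open>entry \<open>(k, 2)\<close> of \<open>D\<close> times the adjugate of \<open>B\<close>\<close>
  define e where "e z = D z $ k $ 2 * B z $ 1 $ 1 - D z $ k $ 1 * B z $ 1 $ 2" for z
  have cont: "continuous_on (ball 0 1) (\<lambda>z. M z $ i $ j)" "continuous_on (ball 0 1) (\<lambda>z. C z $ i $ j)"
    "continuous_on (ball 0 1) (\<lambda>z. B z $ i $ j)" "continuous_on (ball 0 1) (\<lambda>z. G z $ i $ j)"
    "continuous_on (ball 0 1) ?b" for i j
  proof -
    show "continuous_on (ball 0 1) (\<lambda>z. M z $ i $ j)" by (rule analytic_continuous_on_ball[OF M])
    show "continuous_on (ball 0 1) (\<lambda>z. C z $ i $ j)" by (rule analytic_continuous_on_ball[OF C])
    show "continuous_on (ball 0 1) (\<lambda>z. B z $ i $ j)"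
      by (rule analytic_continuous_on_ball[OF blaschke_potapov_analytic[OF B]])
    show "continuous_on (ball 0 1) (\<lambda>z. G z $ i $ j)"
      using G by (intro holomorphic_on_imp_continuous_on) (simp add: bounded_analytic_on_disk_def)
    show "continuous_on (ball 0 1) ?b"
      by (rule analytic_continuous_on_ball[OF blaschke_list_analytic[OF ls]])
  qed
  have cont_e: "continuous_on (ball 0 1) e"
    unfolding e_def D_def matrix_mult_2_nth vector_minus_component
    by (intro continuous_on_diff continuous_on_add continuous_on_mult cont)
  have "length ls \<le> length ms"
  proof (rule blaschke_divisor_length[OF ls ms(3) ms(1) _ cont_e M_nz])
    fix z :: complex assume z: "z \<in> ball 0 1"
    have "M z $ k $ 2 * det (B z) = ?b z * e z"
    proof (rule continuous_eq_off_finite_ball[where X = ?Y, OF _ _ _ _ z])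
      fix z assume z: "z \<in> ball 0 1 - ?Y"
      have GR: "G z = R z ** B z" using z by auto
      have M_eq: "M z $ k $ l = ?b z * (R z $ k $ l - C z $ k $ l)" for l
        using R[of z k l] z unfolding right_diff_distrib by simp
      have MB: "M z $ k $ 1 * B z $ 1 $ j + M z $ k $ 2 * B z $ 2 $ j = ?b z * D z $ k $ j" for j
        unfolding M_eq D_def GR vector_minus_component matrix_mult_2_nth
        by (simp only: algebra_simps)
      have "?b z * e z = (?b z * D z $ k $ 2) * B z $ 1 $ 1 - (?b z * D z $ k $ 1) * B z $ 1 $ 2"
        by (simp add: e_def algebra_simps)
      also have "\<dots> = M z $ k $ 2 * det (B z)"
        unfolding MB[symmetric] by (simp add: det_2 algebra_simps)
      finally show "M z $ k $ 2 * det (B z) = ?b z * e z" ..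
    next
      show "continuous_on (ball 0 1) (\<lambda>z. M z $ k $ 2 * det (B z))"
        unfolding det_2 by (intro continuous_on_diff continuous_on_mult cont)
      show "continuous_on (ball 0 1) (\<lambda>z. ?b z * e z)"
        by (intro continuous_on_mult cont cont_e)
      show "finite ?Y" using fin \<open>finite X\<close> by simp
    qed
    then show "M z $ k $ 2 * (c * blaschke_list ms z) = ?b z * e z"
      by (simp add: ms(4))
  qed (use cont in auto)
  then show ?thesis using ms by simp
qed

text \<open>\<open>mat 1 - P\<close> is the orthogonal projection onto a kernel vector of \<open>A\<close>.\<close>

lemma orthogonal_projection_annihilating:
  fixes A :: "complex^2^2"
  assumes "det A = 0"
  obtains P where "orthogonal_projection_matrix P" "rank P = 1" "A ** (mat 1 - P) = 0"
proof -
  have "\<not> (\<exists>Q. Q ** A = mat 1)"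
    using assms invertible_det_nz[of A] by (metis invertible_left_inverse)
  then obtain x where x: "x \<noteq> 0" "A *v x = 0"
    using matrix_left_invertible_ker[of A] by blast
  define n where "n = x $ 1 * cnj (x $ 1) + x $ 2 * cnj (x $ 2)"
  define Q :: "complex^2^2" where "Q = (\<chi> i j. x $ i * cnj (x $ j) / n)"
  have n_real: "cnj n = n"
    by (simp add: n_def mult.commute)
  have "n = of_real ((norm x)\<^sup>2)"
    unfolding norm_vec2 n_def of_real_add complex_norm_square ..
  then have n: "n \<noteq> 0"
    using x by simp
  have QQ: "Q ** Q = Q"
  proof -
    have "(Q ** Q) $ i $ j = x $ i * cnj (x $ j) * n / (n * n)" for i j
      by (simp add: matrix_mult_2_nth Q_def n_def add_divide_distrib algebra_simps)
    then show ?thesis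
      using n by (simp add: vec_eq_iff Q_def)
  qed
  let ?P = "mat 1 - Q"
  have PP: "?P ** ?P = ?P"
    using QQ by (simp add: matrix_diff_ldistrib_2 matrix_diff_rdistrib_2)
  have herm: "hermitian_adjoint ?P = ?P"
    by (simp add: hermitian_adjoint_def transpose_def map_matrix_def vec_eq_iff mat_def Q_def n_real
        mult.commute)
  have Q1: "trace2 Q = 1"
    using n by (simp add: trace2_def Q_def n_def flip: add_divide_distrib)
  have "trace2 ?P = 1"
    using Q1 by (simp add: trace2_def mat_def algebra_simps)
  then have rank: "rank ?P = 1"
    by (cases rule: projection_cases[OF PP]) (auto simp: trace2_def mat_def)
  have "(A ** Q) $ i $ j = (A *v x) $ i * cnj (x $ j) / n" for i j
    by (simp add: matrix_mult_2_nth matrix_vector_mult_2_nth Q_def add_divide_distrib algebra_simps)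
  then have "A ** Q = 0"
    using x by (simp add: vec_eq_iff)
  then show thesis
    using that[of ?P] PP herm rank by (simp add: orthogonal_projection_matrix_def)
qed

text \<open>If \<open>w\<close> is a zero of the denominator, then the numerator \<open>N w\<close> is singular. A Potapov factor
  \<open>F\<close> of rank one at \<open>w\<close>, acting as the identity on a kernel vector of \<open>N w\<close>, makes \<open>N F\<close> vanish at
  \<open>w\<close>, so that one zero of the denominator cancels. As \<open>det (N F)\<close> acquires one Blaschke
  factor while the cancellation removes two, the new numerator satisfies the hypothesis for the remaining
  zeros. The product \<open>E\<close> accumulates the factors used so far.\<close>

lemma blaschke_potapov_denominator:
  fixes R N E :: "complex \<Rightarrow> complex^2^2"
  assumes "set ls \<subseteq> ball 0 1"
    and "\<And>i j. (\<lambda>z. N z $ i $ j) analytic_on cball 0 1"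
    and "blaschke_potapov e E"
    and "continuous_on (ball 0 1) g"
    and "\<And>z. z \<in> ball 0 1 \<Longrightarrow> det (N z) = blaschke_list ls z * g z"
    and "finite X"
    and "\<And>z i j. z \<in> ball 0 1 - X \<Longrightarrow> blaschke_list ls z * (R z ** E z) $ i $ j = N z $ i $ j"
  shows "\<exists>(B :: complex \<Rightarrow> complex^2^2) G. blaschke_potapov (e + length ls) B \<and>
     (\<forall>i j. (\<lambda>z. G z $ i $ j) analytic_on cball 0 1) \<and> finite {z \<in> ball 0 1. G z \<noteq> R z ** B z}"
  using assms
proof (induction ls arbitrary: N E e X)
  case Nil
  have "{z \<in> ball 0 1. N z \<noteq> R z ** E z} \<subseteq> X"
    using Nil(7) by (auto simp: vec_eq_iff) (metis DiffI mem_ball_0)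
  then show ?case
    using Nil finite_subset by (intro exI[of _ E] exI[of _ N]) auto
next
  case (Cons w ls)
  have w: "w \<in> ball 0 1" and ls: "set ls \<subseteq> ball 0 1"
    using Cons.prems by auto
  have "det (N w) = 0"
    using Cons.prems(5)[OF w] by (simp add: blaschke_factor_def)
  then obtain P where P: "orthogonal_projection_matrix P" "rank P = 1" "N w ** (mat 1 - P) = 0"
    using orthogonal_projection_annihilating by blast
  define F where "F z = mat (blaschke_factor w z) ** P + (mat 1 - P)" for z
  have NF: "(\<lambda>z. (N z ** F z) $ i $ j) analytic_on cball 0 1" for i j
    unfolding F_def by (intro matrix_mult_analytic Cons.prems potapov_factor_analytic w)
  have "N w ** F w = 0"
    using P(3) by (simp add: F_def blaschke_factor_def mat_def vec_eq_iff matrix_mult_2_nth)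
  then have "\<exists>k. k analytic_on cball 0 1 \<and>
      (\<forall>z\<in>cball 0 1. (N z ** F z) $ i $ j = blaschke_factor w z * k z)" for i j
    using analytic_divide_blaschke_factor[OF NF[of i j] w] by (metis zero_index)
  then obtain k where k: "\<And>i j. k i j analytic_on cball 0 1"
    "\<And>i j z. z \<in> cball 0 1 \<Longrightarrow> (N z ** F z) $ i $ j = blaschke_factor w z * k i j z"
    by metis
  define N' :: "complex \<Rightarrow> complex^2^2" where "N' z = (\<chi> i j. k i j z)" for z
  have N': "(\<lambda>z. N' z $ i $ j) analytic_on cball 0 1" for i j
    using k(1) by (simp add: N'_def)
  have bw: "blaschke_factor w z \<noteq> 0" if "z \<in> ball 0 1 - {w}" for z
    using that blaschke_factor_eq_0_iff[OF w, of z] by auto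
  have det: "det (N' z) = blaschke_list ls z * g z" if "z \<in> ball 0 1" for z
  proof (rule continuous_eq_off_finite_ball[where X = "{w}", OF _ _ _ _ that])
    fix z assume z: "z \<in> ball 0 1 - {w}"
    have zc: "z \<in> cball 0 1" using z by auto
    let ?b = "blaschke_factor w z"
    have "?b\<^sup>2 * det (N' z) = det (N z ** F z)"
      by (simp add: det_2 k(2)[OF zc] N'_def power2_eq_square algebra_simps)
    also have "\<dots> = ?b\<^sup>2 * (blaschke_list ls z * g z)"
      using Cons.prems(5)[of z] z P det_potapov_factor[of P ?b]
      by (simp add: det_mul F_def orthogonal_projection_matrix_def power2_eq_square)
    finally show "det (N' z) = blaschke_list ls z * g z"
      using bw[OF z] by simp
  next
    show "continuous_on (ball 0 1) (\<lambda>z. det (N' z))"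
      unfolding det_2
      by (intro continuous_on_diff continuous_on_mult analytic_continuous_on_ball[OF N'])
    show "continuous_on (ball 0 1) (\<lambda>z. blaschke_list ls z * g z)"
      by (intro continuous_on_mult Cons.prems(4) analytic_continuous_on_ball[OF blaschke_list_analytic[OF ls]])
  qed simp
  have "\<exists>(B :: complex \<Rightarrow> complex^2^2) G. blaschke_potapov (Suc e + length ls) B \<and>
     (\<forall>i j. (\<lambda>z. G z $ i $ j) analytic_on cball 0 1) \<and> finite {z \<in> ball 0 1. G z \<noteq> R z ** B z}"
  proof (rule Cons.IH[OF ls N' _ Cons.prems(4) det])
    show "blaschke_potapov (Suc e) (\<lambda>z. E z ** F z)"
      using blaschke_potapov.factor[OF Cons.prems(3) w P(1)] by (simp add: P(2) F_def)
    show "finite (insert w X)" using Cons.prems by simp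
    fix z i j assume z: "z \<in> ball 0 1 - insert w X"
    have zc: "z \<in> cball 0 1" using z by auto
    let ?b = "blaschke_factor w z"
    have "?b * (blaschke_list ls z * (R z ** (E z ** F z)) $ i $ j)
        = blaschke_list (w # ls) z * ((R z ** E z) ** F z) $ i $ j"
      by (simp add: matrix_mul_assoc)
    also have "\<dots> = (\<Sum>l\<in>UNIV. (blaschke_list (w # ls) z * (R z ** E z) $ i $ l) * F z $ l $ j)"
      by (simp add: matrix_mult_2_nth[of "R z ** E z"] sum_2 algebra_simps)
    also have "\<dots> = (\<Sum>l\<in>UNIV. N z $ i $ l * F z $ l $ j)"
      using Cons.prems(7)[of z] z by (intro sum.cong refl) simp
    also have "\<dots> = ?b * N' z $ i $ j"
      using k(2)[OF zc, of i j] by (simp add: matrix_mult_2_nth sum_2 N'_def)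
    finally show "blaschke_list ls z * (R z ** (E z ** F z)) $ i $ j = N' z $ i $ j"
      using bw[of z] z by simp
  qed
  then show ?case by simp
qed

lemma unitary_mat_1: "unitary_matrix (mat 1 :: complex^'n^'n)"
proof -
  have "hermitian_adjoint (mat 1 :: complex^'n^'n) = mat 1"
    by (simp add: hermitian_adjoint_def transpose_def map_matrix_def vec_eq_iff mat_def)
  then show ?thesis by (simp add: unitary_matrix_def)
qed

text \<open>The two bounds combine because \<open>R\<close> and \<open>R - C\<close> are made analytic by the same
  Blaschke--Potapov products \<open>B\<close>, as \<open>C B\<close> is always analytic.\<close>

theorem disk_degree_eqI:
  fixes R M C :: "complex \<Rightarrow> complex^2^2"
  assumes b: "finite_blaschke n b"
    and M: "\<And>i j. (\<lambda>z. M z $ i $ j) analytic_on cball 0 1"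
    and C: "\<And>i j. (\<lambda>z. C z $ i $ j) analytic_on cball 0 1"
    and g: "g analytic_on cball 0 1"
    and X: "finite X"
    and R: "\<And>z i j. z \<in> ball 0 1 - X \<Longrightarrow> b z * R z $ i $ j = M z $ i $ j + b z * C z $ i $ j"
    and det: "\<And>z. z \<in> ball 0 1 \<Longrightarrow> det (M z) = b z * g z"
    and M_nz: "\<And>w. w \<in> ball 0 1 \<Longrightarrow> b w = 0 \<Longrightarrow> M w $ k $ 2 \<noteq> 0"
  shows "disk_degree R = n"
proof -
  obtain c ls where "norm c = 1" and ls: "length ls = n" "set ls \<subseteq> ball 0 1"
    and bc: "b = (\<lambda>z. c * blaschke_list ls z)"
    using b unfolding finite_blaschke_def by blast
  then have c: "c \<noteq> 0" by auto
  define N :: "complex \<Rightarrow> complex^2^2" where "N z = (\<chi> i j. M z $ i $ j / c)" for z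
  have N: "(\<lambda>z. N z $ i $ j) analytic_on cball 0 1" for i j
    using c by (auto simp: N_def intro!: analytic_intros M)
  have RN: "blaschke_list ls z * R z $ i $ j = N z $ i $ j + blaschke_list ls z * C z $ i $ j"
    if "z \<in> ball 0 1 - X" for z i j
    using R[OF that, of i j] c by (simp add: bc N_def field_simps)
  have detN: "det (N z) = blaschke_list ls z * (g z / c)" if "z \<in> ball 0 1" for z
  proof -
    have "det (N z) = det (M z) / (c * c)"
      by (simp add: det_2 N_def diff_divide_distrib)
    then show ?thesis using det[OF that] c by (simp add: bc)
  qed
  have "\<exists>(B :: complex \<Rightarrow> complex^2^2) G. blaschke_potapov (0 + length ls) B \<and>
     (\<forall>i j. (\<lambda>z. G z $ i $ j) analytic_on cball 0 1) \<and>
     finite {z \<in> ball 0 1. G z \<noteq> (R z - C z) ** B z}"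
  proof (rule blaschke_potapov_denominator[OF ls(2) N _ _ detN X])
    show "blaschke_potapov 0 (\<lambda>z. mat 1 :: complex^2^2)"
      by (rule blaschke_potapov.const[OF unitary_mat_1])
    show "continuous_on (ball 0 1) (\<lambda>z. g z / c)"
      using c by (intro continuous_intros analytic_continuous_on_ball[OF g]) auto
    show "blaschke_list ls z * ((R z - C z) ** mat 1) $ i $ j = N z $ i $ j"
      if "z \<in> ball 0 1 - X" for z i j
      using RN[OF that, of i j] by (simp add: algebra_simps)
  qed
  then obtain B :: "complex \<Rightarrow> complex^2^2" and G where B: "blaschke_potapov n B"
    and G: "\<And>i j. (\<lambda>z. G z $ i $ j) analytic_on cball 0 1"
    and fin: "finite {z \<in> ball 0 1. G z \<noteq> (R z - C z) ** B z}"
    using ls by auto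
  have "(\<lambda>z. (G z + C z ** B z) $ i $ j) analytic_on cball 0 1" for i j
    unfolding vector_add_component
    by (intro analytic_intros G matrix_mult_analytic C blaschke_potapov_analytic[OF B])
  then have G': "bounded_analytic_on_disk (\<lambda>z. G z + C z ** B z)"
    by (rule analytic_entries_bounded_analytic)
  have "{z \<in> ball 0 1. G z + C z ** B z \<noteq> R z ** B z} \<subseteq> {z \<in> ball 0 1. G z \<noteq> (R z - C z) ** B z}"
    by (auto simp: matrix_diff_rdistrib_2)
  then have fin': "finite {z \<in> ball 0 1. G z + C z ** B z \<noteq> R z ** B z}"
    using fin by (rule finite_subset)
  show ?thesis
    unfolding disk_degree_def
  proof (rule Least_equality)
    show "\<exists>(B :: complex \<Rightarrow> complex^2^2) G. blaschke_potapov n B \<and> bounded_analytic_on_disk G \<and>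
        finite {z \<in> ball 0 1. G z \<noteq> R z ** B z}"
      using B G' fin' by (intro exI[of _ B] exI[of _ "\<lambda>z. G z + C z ** B z"] conjI)
  next
    fix d assume "\<exists>(B :: complex \<Rightarrow> complex^2^2) G. blaschke_potapov d B \<and>
        bounded_analytic_on_disk G \<and> finite {z \<in> ball 0 1. G z \<noteq> R z ** B z}"
    then obtain B :: "complex \<Rightarrow> complex^2^2" and G where "blaschke_potapov d B"
        "bounded_analytic_on_disk G" "finite {z \<in> ball 0 1. G z \<noteq> R z ** B z}" by blast
    moreover have "N w $ k $ 2 \<noteq> 0" if "w \<in> set ls" for w
      using M_nz[of w] blaschke_list_eq_0_iff[OF ls(2), of w] ls(2) that c by (auto simp: N_def bc)
    ultimately show "n \<le> d"
      using disk_degree_lower_bound[OF ls(2) N C X RN] ls(1) by blast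
  qed
qed

section \<open>Polynomial representations\<close>

abbreviation root_poly :: "complex list \<Rightarrow> complex poly" where
  "root_poly ls \<equiv> (\<Prod>w\<leftarrow>ls. [:w, - 1:])"

lemma poly_root_poly_eq_0_iff: "poly (root_poly ls) z = 0 \<longleftrightarrow> z \<in> set ls"
  by (induction ls) auto

lemma root_poly_nonzero: "root_poly ls \<noteq> 0"
  by (induction ls) (simp_all del: mult_pCons_left)

lemma degree_root_poly: "degree (root_poly ls) = length ls"
proof (induction ls)
  case (Cons w ls)
  have "degree ([:w, - 1:] * root_poly ls) = degree [:w, - 1:] + degree (root_poly ls)"
    by (rule degree_mult_eq) (auto simp: root_poly_nonzero)
  then show ?case using Cons by simp
qed simp

text \<open>Partial fractions with the poles at the points of \<open>ls\<close> on one side and the zeros of \<open>Q\<close> on the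
  other. In the induction step the constant \<open>\<alpha>\<close> is chosen such that \<open>s - \<alpha> Q\<close> vanishes at the new
  point.\<close>

lemma partial_fraction_split:
  fixes n Q :: "complex poly"
  assumes "\<And>w. w \<in> set ls \<Longrightarrow> poly Q w \<noteq> 0"
  shows "\<exists>r s. n = r * Q + s * root_poly ls \<and> (r = 0 \<or> degree r < length ls)"
  using assms
proof (induction ls)
  case Nil
  show ?case by (intro exI[of _ 0] exI[of _ n]) simp
next
  case (Cons w ls)
  then obtain r s where rs: "n = r * Q + s * root_poly ls" "r = 0 \<or> degree r < length ls"
    by auto
  define \<alpha> where "\<alpha> = poly s w / poly Q w"
  have "poly (s - smult \<alpha> Q) w = 0"
    using Cons.prems[of w] by (simp add: \<alpha>_def)
  then obtain s' where "s - smult \<alpha> Q = [:- w, 1:] * s'"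
    unfolding poly_eq_0_iff_dvd by (rule dvdE)
  then have s: "s = smult \<alpha> Q + [:w, - 1:] * (- s')"
    by (simp add: algebra_simps)
  have "degree (r + smult \<alpha> (root_poly ls)) \<le> length ls"
  proof (rule degree_add_le)
    show "degree r \<le> length ls" using rs(2) by auto
    show "degree (smult \<alpha> (root_poly ls)) \<le> length ls"
      using degree_smult_le[of \<alpha> "root_poly ls"] by (simp add: degree_root_poly)
  qed
  moreover have "n = (r + smult \<alpha> (root_poly ls)) * Q + (- s') * root_poly (w # ls)"
    unfolding rs(1) by (subst s) (simp add: algebra_simps del: mult_pCons_left mult_pCons_right)
  ultimately show ?case
    by (intro exI[of _ "r + smult \<alpha> (root_poly ls)"] exI[of _ "- s'"]) auto
qed

lemma root_poly_dvd_by_order: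
  assumes "N \<noteq> 0" "\<And>w. w \<in> set ls \<Longrightarrow> order w (root_poly ls) \<le> order w N"
  shows "root_poly ls dvd N"
  using assms
proof (induction ls arbitrary: N)
  case (Cons w ls)
  have "order w (root_poly (w # ls)) \<noteq> 0"
    using order_root[of "root_poly (w # ls)" w] poly_root_poly_eq_0_iff[of "w # ls" w]
      root_poly_nonzero[of "w # ls"] by simp
  then have "order w N \<noteq> 0"
    using Cons.prems(2)[of w] by simp
  then have "poly N w = 0"
    by (simp add: order_root)
  then obtain N1 where "N = [:- w, 1:] * N1"
    by (auto simp: poly_eq_0_iff_dvd)
  then have N: "N = [:w, - 1:] * (- N1)"
    by (simp add: algebra_simps)
  have nz: "N1 \<noteq> 0" using Cons.prems(1) N by auto
  have "root_poly ls dvd - N1"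
  proof (rule Cons.IH)
    fix v assume v: "v \<in> set ls"
    have "order v [:w, - 1:] + order v (root_poly ls) \<le> order v [:w, - 1:] + order v (- N1)"
      using Cons.prems(2)[of v] v nz root_poly_nonzero[of ls] unfolding N
      by (simp add: order_mult[symmetric] del: mult_pCons_left mult_pCons_right)
    then show "order v (root_poly ls) \<le> order v (- N1)" by simp
  qed (use nz in simp)
  then show ?case
    unfolding N by (simp add: mult_dvd_mono del: mult_pCons_left mult_pCons_right)
qed simp

lemma zorder_rational:
  fixes p q :: "complex poly"
  assumes "p \<noteq> 0" "poly q w \<noteq> 0" "\<And>z. poly q z \<noteq> 0 \<Longrightarrow> f z = poly p z / poly q z"
  shows "zorder f w = int (order w p)"
proof -
  obtain p1 where p1: "p = [:- w, 1:] ^ order w p * p1" "\<not> [:- w, 1:] dvd p1"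
    using order_decomp[OF assms(1)] by blast
  show ?thesis
  proof (rule zorder_eqI[where S = "{z. poly q z \<noteq> 0}" and g = "\<lambda>z. poly p1 z / poly q z"])
    show "open {z. poly q z \<noteq> 0}"
      by (intro open_Collect_neq continuous_intros)
    show "f z = poly p1 z / poly q z * (z - w) powi int (order w p)"
      if "z \<in> {z. poly q z \<noteq> 0}" "z \<noteq> w" for z
    proof -
      have "poly p z = (z - w) ^ order w p * poly p1 z"
        by (subst p1(1)) (simp add: poly_power)
      then show ?thesis using assms(3)[of z] that by simp
    qed
  qed (use assms p1(2) in \<open>auto intro!: holomorphic_intros simp: poly_eq_0_iff_dvd\<close>)
qed

lemma finite_blaschke_rational:
  assumes "finite_blaschke d B"
  obtains c ls Q where "cmod c = 1" "length ls = d" "set ls \<subseteq> ball 0 1" "degree Q \<le> d"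
    "\<And>z. z \<in> cball 0 1 \<Longrightarrow> poly Q z \<noteq> 0" "\<And>z. B z = c * poly (root_poly ls) z / poly Q z"
proof -
  obtain c ls where ls: "cmod c = 1" "length ls = d" "set ls \<subseteq> ball 0 1"
    and B: "B = (\<lambda>z. c * blaschke_list ls z)"
    using assms unfolding finite_blaschke_def by blast
  define Q where "Q = (\<Prod>w\<leftarrow>ls. [:1, - cnj w:])"
  have "degree Q \<le> sum_list (map degree (map (\<lambda>w. [:1, - cnj w:]) ls))"
    unfolding Q_def by (rule degree_prod_list_le)
  also have "\<dots> \<le> sum_list (map (\<lambda>_. 1) ls)"
    unfolding map_map o_def by (intro sum_list_mono) simp
  also have "\<dots> = d" using ls by (simp add: sum_list_triv)
  finally have "degree Q \<le> d" .
  moreover have "poly Q z \<noteq> 0" if "z \<in> cball 0 1" for z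
    unfolding Q_def using ls(3)
  proof (induction ls)
    case (Cons w ls)
    then show ?case
      using blaschke_denominator_nonzero[of w z] that by (simp add: mult.commute)
  qed simp
  moreover have "B z = c * poly (root_poly ls) z / poly Q z" for z
  proof -
    have "blaschke_list ls z = poly (root_poly ls) z / poly Q z"
      unfolding Q_def
      by (induction ls) (simp_all add: blaschke_factor_def mult_ac del: mult_pCons_left mult_pCons_right)
    then show ?thesis by (simp add: B)
  qed
  ultimately show thesis using that ls by blast
qed

section \<open>Finite Blaschke products on the circle and under reflection\<close>

lemma finite_blaschke_analytic: "finite_blaschke d B \<Longrightarrow> B analytic_on cball 0 1"
  unfolding finite_blaschke_def
  by (auto intro!: analytic_on_mult analytic_on_const blaschke_list_analytic)

lemma norm_finite_blaschke:
  assumes "finite_blaschke d B" "\<zeta> \<in> sphere 0 1"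
  shows "cmod (B \<zeta>) = 1"
proof -
  obtain c ls where ls: "cmod c = 1" "set ls \<subseteq> ball 0 1" and B: "B = (\<lambda>z. c * blaschke_list ls z)"
    using assms unfolding finite_blaschke_def by blast
  have factor: "cmod (blaschke_factor w \<zeta>) = 1" if "w \<in> ball 0 1" for w
  proof -
    have "\<zeta> * cnj \<zeta> = 1"
      using assms(2) complex_norm_square[of \<zeta>] by simp
    then have "w - \<zeta> = - \<zeta> * cnj (1 - cnj w * \<zeta>)"
      by (simp add: algebra_simps)
    then have "cmod (w - \<zeta>) = cmod (1 - cnj w * \<zeta>)"
      using assms(2) by (simp add: norm_mult del: complex_cnj_diff complex_cnj_mult)
    then show ?thesis
      using blaschke_denominator_nonzero[OF that, of \<zeta>] assms(2)
      by (simp add: blaschke_factor_def norm_divide)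
  qed
  have "cmod (blaschke_list ls \<zeta>) = 1"
    using ls(2) by (induction ls) (auto simp: norm_mult factor)
  then show ?thesis using ls by (simp add: B norm_mult)
qed

lemma finite_blaschke_mult:
  assumes "finite_blaschke m A" "finite_blaschke n B"
  shows "finite_blaschke (m + n) (\<lambda>z. A z * B z)"
proof -
  obtain c ls where 1: "cmod c = 1" "length ls = m" "set ls \<subseteq> ball 0 1" "A = (\<lambda>z. c * blaschke_list ls z)"
    using assms(1) unfolding finite_blaschke_def by blast
  obtain c' ls' where 2: "cmod c' = 1" "length ls' = n" "set ls' \<subseteq> ball 0 1" "B = (\<lambda>z. c' * blaschke_list ls' z)"
    using assms(2) unfolding finite_blaschke_def by blast
  show ?thesis
    unfolding finite_blaschke_def using 1 2
    by (intro exI[of _ "c * c'"] exI[of _ "ls @ ls'"]) (auto simp: norm_mult mult_ac)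
qed

lemma blaschke_factor_cnj: "cnj (blaschke_factor w (cnj z)) = blaschke_factor (cnj w) z"
  by (simp add: blaschke_factor_def)

lemma finite_blaschke_cnj:
  assumes "finite_blaschke d B"
  shows "finite_blaschke d (\<lambda>z. cnj (B (cnj z)))"
proof -
  obtain c ls where 1: "cmod c = 1" "length ls = d" "set ls \<subseteq> ball 0 1" "B = (\<lambda>z. c * blaschke_list ls z)"
    using assms(1) unfolding finite_blaschke_def by blast
  have "cnj (blaschke_list ls (cnj z)) = blaschke_list (map cnj ls) z" for z
    by (induction ls) (simp_all add: blaschke_factor_cnj)
  then show ?thesis
    unfolding finite_blaschke_def using 1
    by (intro exI[of _ "cnj c"] exI[of _ "map cnj ls"]) auto
qed

text \<open>The points with \<open>B (1/z) = 0\<close> are excluded because there \<open>1/z\<close> is either a zero or a pole of \<open>B\<close>,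
  and a pole carries the conventional value zero.\<close>

lemma finite_blaschke_reflection:
  assumes "finite_blaschke d B" "z \<noteq> 0" "B (1 / z) \<noteq> 0"
  shows "B (1 / z) = 1 / cnj (B (cnj z))" "cnj (B (cnj z)) \<noteq> 0"
proof -
  obtain c ls where c: "cmod c = 1" and B: "B = (\<lambda>z. c * blaschke_list ls z)"
    using assms(1) unfolding finite_blaschke_def by blast
  have factor: "blaschke_factor w (1 / z) * blaschke_factor (cnj w) z = 1"
    if nz: "blaschke_factor w (1 / z) \<noteq> 0" for w
  proof -
    have "w - 1 / z = (w * z - 1) / z" "1 - cnj w * (1 / z) = (z - cnj w) / z"
      using assms(2) by (auto simp: field_simps)
    then have eq: "blaschke_factor w (1 / z) = (w * z - 1) / (z - cnj w)"
      using assms(2) by (simp add: blaschke_factor_def)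
    then have "w * z - 1 \<noteq> 0" "z - cnj w \<noteq> 0" "1 - w * z \<noteq> 0"
      using nz by auto
    moreover have "blaschke_factor (cnj w) z = - (z - cnj w) / - (w * z - 1)"
      by (simp add: blaschke_factor_def)
    moreover have "u / v * (- v / - u) = 1" if "u \<noteq> 0" "v \<noteq> 0" for u v :: complex
      using that by simp
    ultimately show ?thesis
      unfolding eq by (simp only:)
  qed
  have "blaschke_list ls (1 / z) * cnj (blaschke_list ls (cnj z)) = 1"
    if "blaschke_list ls (1 / z) \<noteq> 0"
    using that
  proof (induction ls)
    case (Cons w ls)
    then have "blaschke_list ls (1 / z) * cnj (blaschke_list ls (cnj z)) = 1"
      "blaschke_factor w (1 / z) * cnj (blaschke_factor w (cnj z)) = 1"
      using factor[of w] by (auto simp: blaschke_factor_cnj)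
    then have "(blaschke_factor w (1 / z) * cnj (blaschke_factor w (cnj z))) *
        (blaschke_list ls (1 / z) * cnj (blaschke_list ls (cnj z))) = 1"
      by simp
    then show ?case by (simp add: mult_ac)
  qed simp
  moreover have "c * cnj c = 1"
    using c complex_norm_square[of c] by simp
  moreover have "blaschke_list ls (1 / z) \<noteq> 0"
    using assms(3) by (auto simp: B)
  ultimately have "(c * cnj c) * (blaschke_list ls (1 / z) * cnj (blaschke_list ls (cnj z))) = 1"
    by simp
  then have 1: "B (1 / z) * cnj (B (cnj z)) = 1"
    by (simp add: B mult_ac)
  then show nz: "cnj (B (cnj z)) \<noteq> 0" by auto
  show "B (1 / z) = 1 / cnj (B (cnj z))"
    using 1 nz by (simp add: nonzero_eq_divide_eq)
qed

section \<open>The symbol built from three Blaschke products\<close>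

text \<open>The polynomial form of the data. The equation for \<open>S\<close> expresses that the numerator of
  \<open>1 - t a\<^sup>2 B1 B2\<close> is divisible by that of \<open>B0\<close>.\<close>

locale blaschke_symbol =
  fixes k :: nat and t a :: real and B0 B1 B2 :: "complex \<Rightarrow> complex"
    and c0 c1 c2 :: complex and l0 l1 l2 :: "complex list" and Q0 Q1 Q2 S :: "complex poly"
  assumes k: "2 \<le> k" and t: "0 < t" "t < 1" and a: "0 < a"
    and blaschke: "finite_blaschke (k - 1) B0" "finite_blaschke k B1" "finite_blaschke (k - 2) B2"
    and c_norm: "cmod c0 = 1" "cmod c1 = 1" "cmod c2 = 1"
    and l_length: "length l0 = k - 1" "length l1 = k" "length l2 = k - 2"
    and l_set: "set l0 \<subseteq> ball 0 1" "set l1 \<subseteq> ball 0 1" "set l2 \<subseteq> ball 0 1"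
    and Q_degree: "degree Q0 \<le> k - 1"
    and Q_nz: "\<And>z. z \<in> cball 0 1 \<Longrightarrow> poly Q0 z \<noteq> 0" "\<And>z. z \<in> cball 0 1 \<Longrightarrow> poly Q1 z \<noteq> 0"
      "\<And>z. z \<in> cball 0 1 \<Longrightarrow> poly Q2 z \<noteq> 0"
    and B: "\<And>z. B0 z = c0 * poly (root_poly l0) z / poly Q0 z"
      "\<And>z. B1 z = c1 * poly (root_poly l1) z / poly Q1 z"
      "\<And>z. B2 z = c2 * poly (root_poly l2) z / poly Q2 z"
    and S: "Q1 * Q2 - smult (of_real (t * a\<^sup>2) * c1 * c2) (root_poly l1 * root_poly l2) = root_poly l0 * S"
begin

abbreviation "P0 \<equiv> root_poly l0"
abbreviation "P1 \<equiv> root_poly l1"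
abbreviation "P2 \<equiv> root_poly l2"

definition symbol :: "complex \<Rightarrow> complex^2^2" where
  "symbol z = framed_diag a (B0 z) (B0 z / B1 z) (of_real t * (B2 z / B0 z))"

lemma symbol_nth:
  assumes "B0 z \<noteq> 0"
  shows "symbol z $ 1 $ 1 = B0 z / B1 z / (B0 z)\<^sup>2 - (of_real a)\<^sup>2 * (of_real t * (B2 z / B0 z))"
    "symbol z $ 1 $ 2 = of_real a * (B0 z / B1 z / B0 z + B0 z * (of_real t * (B2 z / B0 z)))"
    "symbol z $ 2 $ 1 = - of_real a * (B0 z / B1 z / B0 z + B0 z * (of_real t * (B2 z / B0 z)))"
    "symbol z $ 2 $ 2 = (B0 z)\<^sup>2 * (of_real t * (B2 z / B0 z)) - (of_real a)\<^sup>2 * (B0 z / B1 z)"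
  unfolding symbol_def by (rule framed_diag_nth[OF assms])+

text \<open>The numerators of the entries over the common denominator \<open>P1 Q0 Q2\<close>; \<open>P0\<close> does not occur in
  the denominator because it cancels against the numerator of \<open>1 - t a\<^sup>2 B1 B2\<close>.\<close>

definition numer :: "complex poly^2^2" where
  "numer = (let n = Q0 * (smult (of_real a / c1) (Q1 * Q2) + smult (of_real (a * t) * c2) (P1 * P2))
     in mat2 (smult (1 / (c0 * c1)) (S * Q0\<^sup>2)) n (- n)
          (P0 * (smult (c0 * of_real t * c2) (P1 * P2) - smult (c0 * (of_real a)\<^sup>2 / c1) (Q1 * Q2))))"

definition exceptional :: "complex set" where
  "exceptional = {z. poly (P0 * P1 * P2 * Q0 * Q1 * Q2) z = 0}"

lemma Q_neq_0: "Q0 \<noteq> 0" "Q1 \<noteq> 0" "Q2 \<noteq> 0"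
  using Q_nz[of 0] by auto

lemma c_neq_0: "c0 \<noteq> 0" "c1 \<noteq> 0" "c2 \<noteq> 0"
  using c_norm by auto

lemma finite_exceptional: "finite exceptional"
  unfolding exceptional_def
  by (rule poly_roots_finite) (simp add: root_poly_nonzero Q_neq_0)

lemma not_exceptional:
  assumes "z \<notin> exceptional"
  shows "poly P0 z \<noteq> 0" "poly P1 z \<noteq> 0" "poly Q0 z \<noteq> 0" "poly Q1 z \<noteq> 0" "poly Q2 z \<noteq> 0"
    "B0 z \<noteq> 0" "B1 z \<noteq> 0" "B2 z \<noteq> 0"
  using assms c_neq_0 by (auto simp: exceptional_def B)

lemma sphere_not_exceptional: "\<zeta> \<in> sphere 0 1 \<Longrightarrow> \<zeta> \<notin> exceptional"
  using l_set Q_nz[of \<zeta>] by (auto simp: exceptional_def poly_root_poly_eq_0_iff)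

lemma poly_S: "poly P0 z * poly S z =
    poly Q1 z * poly Q2 z - of_real t * (of_real a)\<^sup>2 * c1 * c2 * (poly P1 z * poly P2 z)"
  using arg_cong[OF S, of "\<lambda>p. poly p z"] by (simp add: mult_ac)

lemma symbol_rational:
  assumes "z \<notin> exceptional"
  shows "symbol z $ i $ j = poly (numer $ i $ j) z / (poly P1 z * (poly Q0 z * poly Q2 z))"
proof -
  note nz = not_exceptional[OF assms] c_neq_0
  have s: "poly S z = (poly Q1 z * poly Q2 z - of_real t * (of_real a)\<^sup>2 * c1 * c2 * (poly P1 z * poly P2 z)) / poly P0 z"
    using poly_S[of z] nz by (simp add: field_simps)
  have "symbol z $ 1 $ 1 = poly (numer $ 1 $ 1) z / (poly P1 z * (poly Q0 z * poly Q2 z))"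
    unfolding symbol_nth[OF nz(6)] numer_def Let_def mat2_nth poly_smult poly_mult poly_power s B
    using nz by (simp add: field_simps power2_eq_square)
  moreover have "symbol z $ 1 $ 2 = poly (numer $ 1 $ 2) z / (poly P1 z * (poly Q0 z * poly Q2 z))"
    unfolding symbol_nth[OF nz(6)] numer_def Let_def mat2_nth poly_smult poly_mult poly_add B
    using nz by (simp add: field_simps)
  moreover have "symbol z $ 2 $ 1 = poly (numer $ 2 $ 1) z / (poly P1 z * (poly Q0 z * poly Q2 z))"
    unfolding symbol_nth[OF nz(6)] numer_def Let_def mat2_nth poly_smult poly_mult poly_add poly_minus B
    using nz by (simp add: field_simps)
  moreover have "symbol z $ 2 $ 2 = poly (numer $ 2 $ 2) z / (poly P1 z * (poly Q0 z * poly Q2 z))"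
    unfolding symbol_nth[OF nz(6)] numer_def Let_def mat2_nth poly_smult poly_mult poly_diff B
    using nz by (simp add: field_simps power2_eq_square)
  ultimately show ?thesis
    using exhaust_2[of i] exhaust_2[of j] by auto
qed

text \<open>The multipliers \<open>Q0/Q1\<close> and \<open>Q2/Q0\<close> turn the quotients of Blaschke products into the
  strictly proper functions \<open>Q0/P1\<close>, \<open>P0/P1\<close> and \<open>P2/P0\<close>, up to constants. This is where the
  degrees \<open>k > k - 1 > k - 2\<close> enter.\<close>

lemma extremal: "extremal_symbol a t B0 B1 B2 (\<lambda>z. poly Q0 z / poly Q1 z) (\<lambda>z. poly Q2 z / poly Q0 z) symbol"
proof
  note sph = sphere_not_exceptional[THEN not_exceptional(3)] sphere_not_exceptional[THEN not_exceptional(4)]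
    sphere_not_exceptional[THEN not_exceptional(5)] sphere_not_exceptional[THEN not_exceptional(1)]
    sphere_not_exceptional[THEN not_exceptional(2)]
  have anti: "antianalytic (\<lambda>\<zeta>. poly r \<zeta> / poly (root_poly ls) \<zeta>)"
    if "degree r < length ls" "set ls \<subseteq> ball 0 1" for r ls
  proof -
    have "degree r < degree (root_poly ls)" "\<And>z. poly (root_poly ls) z = 0 \<Longrightarrow> z \<in> ball 0 1"
      using that by (auto simp: degree_root_poly poly_root_poly_eq_0_iff)
    from cnj_strictly_proper_on_circle[OF this] show ?thesis
      unfolding antianalytic_def by metis
  qed
  show "antianalytic (\<lambda>\<zeta>. poly Q0 \<zeta> / poly Q1 \<zeta> / B1 \<zeta>)"
    by (rule antianalytic_cmult[OF anti[of Q0 l1], of _ "1 / c1"])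
       (use Q_degree k l_length l_set sph c_neq_0 in \<open>auto simp: B\<close>)
  show "antianalytic (\<lambda>\<zeta>. poly Q0 \<zeta> / poly Q1 \<zeta> * B0 \<zeta> / B1 \<zeta>)"
    by (rule antianalytic_cmult[OF anti[of P0 l1], of _ "c0 / c1"])
       (use k l_length l_set sph c_neq_0 in \<open>auto simp: B degree_root_poly\<close>)
  show "antianalytic (\<lambda>\<zeta>. poly Q2 \<zeta> / poly Q0 \<zeta> * B2 \<zeta> / B0 \<zeta>)"
    by (rule antianalytic_cmult[OF anti[of P2 l0], of _ "c2 / c0"])
       (use k l_length l_set sph c_neq_0 in \<open>auto simp: B degree_root_poly\<close>)
qed (use t a norm_finite_blaschke[OF blaschke(1)] norm_finite_blaschke[OF blaschke(2)]
       norm_finite_blaschke[OF blaschke(3)] finite_blaschke_analytic[OF blaschke(1)] Q_nz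
     in \<open>auto simp: symbol_def intro!: analytic_intros\<close>)

lemma ex_split: "\<exists>r s. \<forall>i j. numer $ i $ j = r i j * (Q0 * Q2) + s i j * P1 \<and> degree (r i j) < k"
proof -
  have "\<exists>r s. n = r * (Q0 * Q2) + s * P1 \<and> (r = 0 \<or> degree r < length l1)" for n
    by (rule partial_fraction_split) (use l_set Q_nz in auto)
  then have "\<exists>r s. n = r * (Q0 * Q2) + s * P1 \<and> degree r < k" for n
    using k unfolding l_length(2) by (metis degree_0 gr0I not_numeral_le_zero)
  then obtain f g where "\<And>n. n = f n * (Q0 * Q2) + g n * P1 \<and> degree (f n) < k"
    by metis
  then show ?thesis
    by (intro exI[of _ "\<lambda>i j. f (numer $ i $ j)"] exI[of _ "\<lambda>i j. g (numer $ i $ j)"]) blast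
qed

end

text \<open>The partial fractions \<open>r/P1\<close> collect the poles in the disk, and \<open>s/(Q0 Q2)\<close> those outside.\<close>

locale blaschke_symbol_split = blaschke_symbol +
  fixes r s :: "2 \<Rightarrow> 2 \<Rightarrow> complex poly"
  assumes split: "\<And>i j. numer $ i $ j = r i j * (Q0 * Q2) + s i j * P1"
    and r_degree: "\<And>i j. degree (r i j) < k"
begin

definition anti_part :: "complex \<Rightarrow> complex^2^2" where
  "anti_part z = (\<chi> i j. poly (r i j) z / poly P1 z)"

definition analytic_part :: "complex \<Rightarrow> complex^2^2" where
  "analytic_part z = (\<chi> i j. poly (s i j) z / poly (Q0 * Q2) z)"

lemma symbol_split:
  assumes "z \<notin> exceptional"
  shows "symbol z = anti_part z + analytic_part z"
  using not_exceptional[OF assms]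
  by (simp add: vec_eq_iff symbol_rational[OF assms] split anti_part_def analytic_part_def field_simps)

lemma strictly_proper: "degree (r i j) < degree P1" "\<And>z. poly P1 z = 0 \<Longrightarrow> z \<in> ball 0 1"
  using r_degree l_set by (auto simp: degree_root_poly l_length poly_root_poly_eq_0_iff)

lemma analytic_part_analytic: "(\<lambda>z. analytic_part z $ i $ j) analytic_on cball 0 1"
  using Q_nz by (auto simp: analytic_part_def intro!: analytic_intros)

text \<open>The strictly proper part has no Fourier coefficients of nonnegative index, and the Fourier
  series of the other part is its Taylor series.\<close>

lemma P_plus_symbol:
  assumes \<zeta>: "\<zeta> \<in> sphere 0 1"
  shows "P_plus symbol \<zeta> = analytic_part \<zeta>"
proof -
  have "P_plus symbol \<zeta> $ i $ l = analytic_part \<zeta> $ i $ l" for i l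
  proof -
    have ne: "poly P1 z \<noteq> 0" "z \<noteq> 0" if "z \<in> sphere 0 1" for z
      using not_exceptional(2)[OF sphere_not_exceptional[OF that]] that by auto
    have "fourier_coeff symbol (int j) $ i $ l
        = (LINT z|circle. z powi (- int j) * analytic_part z $ i $ l)" for j
    proof -
      have "fourier_coeff symbol (int j) $ i $ l = (LINT z|circle. z powi (- int j) * symbol z $ i $ l)"
        by (simp add: fourier_coeff_def)
      also have "\<dots> = (LINT z|circle. z powi (- int j) * (poly (r i l) z / poly P1 z)
          + z powi (- int j) * analytic_part z $ i $ l)"
        by (rule Bochner_Integration.integral_cong)
           (simp_all add: symbol_split sphere_not_exceptional anti_part_def distrib_left)
      also have "\<dots> = (LINT z|circle. z powi (- int j) * (poly (r i l) z / poly P1 z))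
          + (LINT z|circle. z powi (- int j) * analytic_part z $ i $ l)"
      proof (rule Bochner_Integration.integral_add)
        show "integrable circle (\<lambda>z. z powi (- int j) * (poly (r i l) z / poly P1 z))"
          by (intro integrable_circle_continuous continuous_intros) (use ne in auto)
        have "continuous_on (sphere 0 1) (\<lambda>z. analytic_part z $ i $ l)"
          by (rule continuous_on_subset[OF holomorphic_on_imp_continuous_on[OF
                analytic_imp_holomorphic[OF analytic_part_analytic]]]) auto
        then have "continuous_on (sphere 0 1) (\<lambda>z. z powi (- int j) * analytic_part z $ i $ l)"
          using ne by (intro continuous_on_mult continuous_on_power_int continuous_on_id) auto
        then show "integrable circle (\<lambda>z. z powi (- int j) * analytic_part z $ i $ l)"
          by (rule integrable_circle_continuous)
      qed
      also have "(LINT z|circle. z powi (- int j) * (poly (r i l) z / poly P1 z)) = 0"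
        by (rule fourier_strictly_proper[OF strictly_proper(1)]) (rule strictly_proper(2))
      finally show ?thesis by simp
    qed
    then have "P_plus symbol \<zeta> $ i $ l
        = (\<Sum>j. (LINT z|circle. z powi (- int j) * analytic_part z $ i $ l) * \<zeta> ^ j)"
      by (simp add: P_plus_def)
    also have "\<dots> = analytic_part \<zeta> $ i $ l"
      using fourier_series_analytic[OF analytic_part_analytic \<zeta>] by (rule sums_unique[symmetric])
    finally show ?thesis .
  qed
  then show ?thesis by (simp add: vec_eq_iff)
qed

lemma P_minus_symbol:
  assumes "\<zeta> \<in> sphere 0 1"
  shows "P_minus symbol \<zeta> = anti_part \<zeta>" "P_minus symbol \<zeta> = symbol \<zeta> - analytic_part \<zeta>"
  by (simp_all add: P_minus_def P_plus_symbol[OF assms] symbol_split[OF sphere_not_exceptional[OF assms]])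

lemma superoptimal: "unique_superoptimal_approximant (P_minus symbol) (\<lambda>z. - analytic_part z)"
proof -
  interpret extremal_symbol a t B0 B1 B2 "\<lambda>z. poly Q0 z / poly Q1 z" "\<lambda>z. poly Q2 z / poly Q0 z" symbol
    by (rule extremal)
  show ?thesis
    by (rule superoptimal_approximant[OF P_minus_symbol(2) analytic_part_analytic])
qed

subsection \<open>The degree of the antianalytic part\<close>

text \<open>\<open>M = B1 * symbol\<close>, whose upper left entry \<open>h\<close> is the analytic quotient of
  \<open>1 - t a\<^sup>2 B1 B2\<close> by \<open>B0\<close>. The entry \<open>a (1 + t B1 B2)\<close> equals \<open>a\<close> at the zeros of \<open>B1\<close>.\<close>

lemma degree_anti_part: "disk_degree anti_part = k"
proof -
  define h where "h z = poly S z * poly Q0 z / (c0 * (poly Q1 z * poly Q2 z))" for z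
  define M :: "complex \<Rightarrow> complex^2^2" where
    "M z = mat2 (h z) (of_real a * (1 + of_real t * (B1 z * B2 z)))
       (- of_real a * (1 + of_real t * (B1 z * B2 z)))
       (B0 z * (of_real t * (B1 z * B2 z) - (of_real a)\<^sup>2))" for z
  note Ban = finite_blaschke_analytic[OF blaschke(1)] finite_blaschke_analytic[OF blaschke(2)]
    finite_blaschke_analytic[OF blaschke(3)]
  have h: "h z * B0 z = 1 - of_real t * (of_real a)\<^sup>2 * (B1 z * B2 z)" if "z \<in> cball 0 1" for z
  proof -
    have "h z * B0 z = (poly P0 z * poly S z) / (poly Q1 z * poly Q2 z)"
      using Q_nz[OF that] c_neq_0 by (simp add: h_def B)
    then show ?thesis
      unfolding poly_S using Q_nz[OF that] by (simp add: B field_simps)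
  qed
  have h_an: "h analytic_on cball 0 1"
    unfolding h_def[abs_def] using Q_nz c_neq_0 by (intro analytic_intros) auto
  show ?thesis
  proof (rule disk_degree_eqI[where M = M and C = "\<lambda>z. - analytic_part z" and X = exceptional
        and g = "\<lambda>z. of_real ((1 + a\<^sup>2)\<^sup>2 * t) * B2 z" and k = 1, OF blaschke(2)])
    show "(\<lambda>z. M z $ i $ j) analytic_on cball 0 1" for i j
      using exhaust_2[of i] exhaust_2[of j]
      by (auto simp: M_def intro!: analytic_intros Ban h_an)
    show "(\<lambda>z. (- analytic_part z) $ i $ j) analytic_on cball 0 1" for i j
      by (simp add: analytic_on_neg analytic_part_analytic)
    show "(\<lambda>z. of_real ((1 + a\<^sup>2)\<^sup>2 * t) * B2 z) analytic_on cball 0 1"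
      by (intro analytic_intros Ban)
    show "finite exceptional" by (rule finite_exceptional)
    show "B1 z * anti_part z $ i $ j = M z $ i $ j + B1 z * (- analytic_part z) $ i $ j"
      if z: "z \<in> ball 0 1 - exceptional" for z i j
    proof -
      have nz: "B0 z \<noteq> 0" "B1 z \<noteq> 0" using not_exceptional z by auto
      have hz: "h z = (1 - of_real t * (of_real a)\<^sup>2 * (B1 z * B2 z)) / B0 z"
        using h[of z] nz z by (simp add: nonzero_eq_divide_eq)
      have "B1 z * symbol z $ i $ j = M z $ i $ j"
        using exhaust_2[of i] exhaust_2[of j] nz
        by (auto simp: symbol_nth[OF nz(1)] M_def hz power2_eq_square field_simps)
      then show ?thesis
        using symbol_split[of z] z by (simp add: algebra_simps)
    qed
    show "det (M z) = B1 z * (of_real ((1 + a\<^sup>2)\<^sup>2 * t) * B2 z)" if z: "z \<in> ball 0 1" for z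
    proof -
      have "det (M z) = (h z * B0 z) * (of_real t * (B1 z * B2 z) - (of_real a)\<^sup>2)
          + (of_real a)\<^sup>2 * (1 + of_real t * (B1 z * B2 z))\<^sup>2"
        by (simp add: det_2 M_def power2_eq_square algebra_simps)
      also have "\<dots> = B1 z * (of_real ((1 + a\<^sup>2)\<^sup>2 * t) * B2 z)"
        using z by (subst h) (auto simp: power2_eq_square algebra_simps)
      finally show ?thesis .
    qed
    show "M w $ 1 $ 2 \<noteq> 0" if "B1 w = 0" for w
      using a that by (simp add: M_def)
  qed
qed

lemma anti_part_at_infinity:
  obtains g where "\<And>i j. g i j analytic_on cball 0 1"
    "\<And>i j z. z \<noteq> 0 \<Longrightarrow> flat anti_part z $ i $ j = z * g i j z"
proof -
  have "\<exists>g. g analytic_on cball 0 1 \<and> (\<forall>z. z \<noteq> 0 \<longrightarrow> flat anti_part z $ i $ j = z * g z)" for i j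
    using strictly_proper_at_infinity[OF strictly_proper]
    unfolding flat_def anti_part_def by simp metis
  then show thesis using that by metis
qed

lemma rational_degree_anti_part: "rational_degree anti_part k"
proof -
  have "rational_matrix_fun anti_part"
    unfolding rational_matrix_fun_def anti_part_def
    using root_poly_nonzero[of l1] by (intro allI exI[of _ P1] exI conjI) auto
  moreover have "all_poles_in_disk anti_part"
    unfolding all_poles_in_disk_def
  proof (intro conjI allI impI)
    fix b assume pole: "matrix_pole anti_part b"
    show "b \<in> ball 0 1"
    proof (rule ccontr)
      assume "b \<notin> ball 0 1"
      then have "poly P1 b \<noteq> 0" using strictly_proper(2) by blast
      then have "(\<lambda>z. anti_part z $ i $ j) analytic_on {b}" for i j
        unfolding anti_part_def by (auto intro!: analytic_intros)
      then show False
        using pole analytic_at_imp_no_pole unfolding matrix_pole_def by blast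
    qed
  next
    obtain g where g: "\<And>i j. g i j analytic_on cball 0 1"
      "\<And>i j z. z \<noteq> 0 \<Longrightarrow> flat anti_part z $ i $ j = z * g i j z"
      using anti_part_at_infinity by blast
    have "\<not> is_pole (\<lambda>z. flat anti_part z $ i $ j) 0" for i j
    proof -
      have "g i j analytic_on {0}"
        using g(1) by (rule analytic_on_subset) auto
      then have "\<not> is_pole (\<lambda>z. z * g i j z) 0"
        by (intro analytic_at_imp_no_pole analytic_intros)
      moreover have ev: "\<forall>\<^sub>F z in at 0. flat anti_part z $ i $ j = z * g i j z"
        using g(2) by (auto simp: eventually_at_filter)
      ultimately show ?thesis
        using is_pole_cong[OF ev refl] by simp
    qed
    then show "\<not> matrix_pole (flat anti_part) 0"
      by (simp add: matrix_pole_def)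
  qed
  ultimately show ?thesis
    using degree_anti_part by (simp add: rational_degree_def)
qed

subsection \<open>The degree of the superoptimal approximant\<close>

text \<open>With \<open>b\<^sub>j z = cnj (B\<^sub>j (cnj z))\<close> one has \<open>B\<^sub>j (1/z) = 1/b\<^sub>j z\<close>, and \<open>M z = - b\<^sub>0 z b\<^sub>2 z * symbol (1/z)\<close>.
  At a zero of \<open>b\<^sub>0\<close> the hypothesis on \<open>B0\<close> gives \<open>t a\<^sup>2 b\<^sub>1 b\<^sub>2 = 1\<close>, so the lower right entry of \<open>M\<close> is
  \<open>1/t - t\<close> there.\<close>

lemma degree_approximant: "disk_degree (flat (\<lambda>z. - analytic_part z)) = 2 * k - 3"
proof -
  define b0 where "b0 z = cnj (B0 (cnj z))" for z
  define b1 where "b1 z = cnj (B1 (cnj z))" for z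
  define b2 where "b2 z = cnj (B2 (cnj z))" for z
  define M :: "complex \<Rightarrow> complex^2^2" where
    "M z = mat2 (- (b0 z)\<^sup>2 * (b1 z * b2 z - of_real t * (of_real a)\<^sup>2))
       (- of_real a * b0 z * (b1 z * b2 z + of_real t))
       (of_real a * b0 z * (b1 z * b2 z + of_real t))
       ((of_real a)\<^sup>2 * (b1 z * b2 z) - of_real t)" for z
  have b: "finite_blaschke (k - 1) b0" "finite_blaschke k b1" "finite_blaschke (k - 2) b2"
    using finite_blaschke_cnj[OF blaschke(1)] finite_blaschke_cnj[OF blaschke(2)]
      finite_blaschke_cnj[OF blaschke(3)] unfolding b0_def[abs_def] b1_def[abs_def] b2_def[abs_def] .
  note ban = finite_blaschke_analytic[OF b(1)] finite_blaschke_analytic[OF b(2)]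
    finite_blaschke_analytic[OF b(3)]
  have bb: "finite_blaschke (2 * k - 3) (\<lambda>z. b0 z * b2 z)"
  proof -
    have "(k - 1) + (k - 2) = 2 * k - 3" using k by simp
    then show ?thesis using finite_blaschke_mult[OF b(1,3)] by simp
  qed
  obtain g where g: "\<And>i j. g i j analytic_on cball 0 1"
    "\<And>i j z. z \<noteq> 0 \<Longrightarrow> flat anti_part z $ i $ j = z * g i j z"
    using anti_part_at_infinity by blast
  \<comment> \<open>the points whose reflection is exceptional, together with the reflection of infinity\<close>
  define X where "X = insert 0 ((\<lambda>z. 1 / z) ` exceptional)"
  have X: "z \<noteq> 0" "1 / z \<notin> exceptional" if "z \<notin> X" for z
    using that by (auto simp: X_def image_iff)
  show ?thesis
  proof (rule disk_degree_eqI[where M = M and C = "\<lambda>z. \<chi> i j. z * g i j z" and X = X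
        and g = "\<lambda>z. of_real ((1 + a\<^sup>2)\<^sup>2 * t) * b0 z * b1 z" and k = 2, OF bb])
    show "(\<lambda>z. M z $ i $ j) analytic_on cball 0 1" for i j
      using exhaust_2[of i] exhaust_2[of j]
      by (auto simp: M_def intro!: analytic_intros ban)
    show "(\<lambda>z. (\<chi> i j. z * g i j z) $ i $ j) analytic_on cball 0 1" for i j
      by (auto intro!: analytic_intros g)
    show "(\<lambda>z. of_real ((1 + a\<^sup>2)\<^sup>2 * t) * b0 z * b1 z) analytic_on cball 0 1"
      by (intro analytic_intros ban)
    show "finite X" by (simp add: X_def finite_exceptional)
    show "b0 z * b2 z * flat (\<lambda>z. - analytic_part z) z $ i $ j
        = M z $ i $ j + b0 z * b2 z * (\<chi> i j. z * g i j z) $ i $ j"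
      if z: "z \<in> ball 0 1 - X" for z i j
    proof -
      note zX = X[of z]
      have z0: "z \<noteq> 0" and ex: "1 / z \<notin> exceptional" using zX z by auto
      note nzB = not_exceptional(6-8)[OF ex]
      note refl = finite_blaschke_reflection[OF blaschke(1) z0 nzB(1), folded b0_def]
        finite_blaschke_reflection[OF blaschke(2) z0 nzB(2), folded b1_def]
        finite_blaschke_reflection[OF blaschke(3) z0 nzB(3), folded b2_def]
      have "b0 z * b2 z * symbol (1 / z) $ i $ j = - M z $ i $ j"
        using exhaust_2[of i] exhaust_2[of j] refl(2,4,6)
        by (auto simp: symbol_nth[OF nzB(1)] refl(1,3,5) M_def power2_eq_square field_simps)
      moreover have "flat (\<lambda>z. - analytic_part z) z $ i $ j = z * g i j z - symbol (1 / z) $ i $ j"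
        using g(2)[OF z0, of i j] symbol_split[OF ex] by (simp add: flat_def)
      ultimately show ?thesis
        by (simp add: right_diff_distrib)
    qed
    show "det (M z) = b0 z * b2 z * (of_real ((1 + a\<^sup>2)\<^sup>2 * t) * b0 z * b1 z)" for z
      by (simp add: det_2 M_def power2_eq_square algebra_simps)
    show "M w $ 2 $ 2 \<noteq> 0" if w: "w \<in> ball 0 1" "b0 w * b2 w = 0" for w
    proof (cases "b2 w = 0")
      case True
      then show ?thesis using t by (simp add: M_def)
    next
      case False
      then have "B0 (cnj w) = 0" using w by (simp add: b0_def)
      then have "poly P0 (cnj w) = 0"
        using w Q_nz(1)[of "cnj w"] c_neq_0 by (simp add: B)
      then have eq: "poly Q1 (cnj w) * poly Q2 (cnj w)
          = of_real t * (of_real a)\<^sup>2 * c1 * c2 * (poly P1 (cnj w) * poly P2 (cnj w))"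
        using poly_S[of "cnj w"] by simp
      have "of_real t * (of_real a)\<^sup>2 * (B1 (cnj w) * B2 (cnj w))
          = of_real t * (of_real a)\<^sup>2 * c1 * c2 * (poly P1 (cnj w) * poly P2 (cnj w))
            / (poly Q1 (cnj w) * poly Q2 (cnj w))"
        by (simp add: B)
      also have "\<dots> = 1"
        unfolding eq[symmetric] using Q_nz(2,3)[of "cnj w"] w by simp
      finally have "of_real t * (of_real a)\<^sup>2 * (B1 (cnj w) * B2 (cnj w)) = 1" .
      then have "cnj (of_real t * (of_real a)\<^sup>2 * (B1 (cnj w) * B2 (cnj w))) = 1"
        by simp
      then have 1: "of_real t * ((of_real a)\<^sup>2 * (b1 w * b2 w)) = 1"
        by (simp add: b1_def b2_def mult_ac)
      show ?thesis
      proof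
        assume "M w $ 2 $ 2 = 0"
        then have "of_real t * of_real t = (1 :: complex)"
          using 1 by (simp add: M_def)
        then have "t * t = 1"
          by (metis of_real_eq_1_iff of_real_mult)
        moreover have "t * t < 1 * 1"
          using t by (intro mult_strict_mono) auto
        ultimately show False by simp
      qed
    qed
  qed
qed

lemma rational_degree_approximant: "rational_degree (\<lambda>z. - analytic_part z) (2 * k - 3)"
proof -
  have "rational_matrix_fun (\<lambda>z. - analytic_part z)"
    unfolding rational_matrix_fun_def analytic_part_def
  proof (intro allI)
    fix i j
    show "\<exists>p q. q \<noteq> 0 \<and> (\<forall>z. poly q z \<noteq> 0 \<longrightarrow>
        (- (\<chi> i j. poly (s i j) z / poly (Q0 * Q2) z)) $ i $ j = poly p z / poly q z)"
      using Q_neq_0 by (intro exI[of _ "- s i j"] exI[of _ "Q0 * Q2"]) simp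
  qed
  moreover have "no_poles_in_closed_disk (\<lambda>z. - analytic_part z)"
    unfolding no_poles_in_closed_disk_def matrix_pole_def
  proof (intro ballI notI, elim exE)
    fix b :: complex and i j
    assume b: "b \<in> cball 0 1" and pole: "is_pole (\<lambda>z. (- analytic_part z) $ i $ j) b"
    have "(\<lambda>z. analytic_part z $ i $ j) analytic_on {b}"
      using b by (intro analytic_on_subset[OF analytic_part_analytic]) auto
    then show False
      using pole analytic_at_imp_no_pole[of "\<lambda>z. analytic_part z $ i $ j" b] by simp
  qed
  ultimately show ?thesis
    using degree_approximant by (simp add: rational_degree_def)
qed

end

theorem corollary4p3:
  fixes k :: nat and t a :: real and B0 B1 B2 :: "complex \<Rightarrow> complex"
    and \<Psi> \<Phi> :: "complex \<Rightarrow> complex^2^2"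
  assumes "k \<ge> 2" and "0 < t" and "t < 1" and "a > 1"
    and "finite_blaschke (k - 1) B0"
    and "finite_blaschke k B1"
    and "finite_blaschke (k - 2) B2"
    and "\<forall>w\<in>ball 0 1. B0 w = 0 \<longrightarrow>
           zorder B0 w \<le> zorder (\<lambda>z. 1 - of_real t * (of_real a)\<^sup>2 * B1 z * B2 z) w"
    and "\<Psi> = (\<lambda>z.
           mat2 (1 / B0 z) (of_real a) (- of_real a) (B0 z) **
           mat2 (B0 z / B1 z) 0 0 (of_real t * (B2 z / B0 z)) **
           mat2 (1 / B0 z) (of_real a) (- of_real a) (B0 z))"
    and "\<Phi> = P_minus \<Psi>"
  shows "mcmillan_degree \<Phi> k \<and>
         (\<exists>A. unique_superoptimal_approximant \<Phi> A \<and> mcmillan_degree A (2 * k - 3))"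
proof -
  obtain c0 l0 Q0 where 0: "cmod c0 = 1" "length l0 = k - 1" "set l0 \<subseteq> ball 0 1" "degree Q0 \<le> k - 1"
    "\<And>z. z \<in> cball 0 1 \<Longrightarrow> poly Q0 z \<noteq> 0" "\<And>z. B0 z = c0 * poly (root_poly l0) z / poly Q0 z"
    using finite_blaschke_rational[OF assms(5)] by blast
  obtain c1 l1 Q1 where 1: "cmod c1 = 1" "length l1 = k" "set l1 \<subseteq> ball 0 1" "degree Q1 \<le> k"
    "\<And>z. z \<in> cball 0 1 \<Longrightarrow> poly Q1 z \<noteq> 0" "\<And>z. B1 z = c1 * poly (root_poly l1) z / poly Q1 z"
    using finite_blaschke_rational[OF assms(6)] by blast
  obtain c2 l2 Q2 where 2: "cmod c2 = 1" "length l2 = k - 2" "set l2 \<subseteq> ball 0 1" "degree Q2 \<le> k - 2"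
    "\<And>z. z \<in> cball 0 1 \<Longrightarrow> poly Q2 z \<noteq> 0" "\<And>z. B2 z = c2 * poly (root_poly l2) z / poly Q2 z"
    using finite_blaschke_rational[OF assms(7)] by blast
  define N where "N = Q1 * Q2 - smult (of_real (t * a\<^sup>2) * c1 * c2) (root_poly l1 * root_poly l2)"
  have poly_N: "poly N z / poly (Q1 * Q2) z = 1 - of_real t * (of_real a)\<^sup>2 * B1 z * B2 z"
    if "poly (Q1 * Q2) z \<noteq> 0" for z
    using that by (simp add: N_def 1(6) 2(6) field_simps)
  \<comment> \<open>at a zero of \<open>B1\<close>, which exists because \<open>k > 0\<close>, the function \<open>1 - t a\<^sup>2 B1 B2\<close> has the value one\<close>
  have "N \<noteq> 0"
  proof
    assume "N = 0"
    obtain w where w: "w \<in> set l1"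
      using 1(2) assms(1) by (cases l1) auto
    then have "poly N w = poly Q1 w * poly Q2 w"
      using poly_root_poly_eq_0_iff[of l1 w] by (simp add: N_def)
    then show False
      using \<open>N = 0\<close> 1(3,5) 2(5) w by (auto dest!: subsetD)
  qed
  have "root_poly l0 dvd N"
  proof (rule root_poly_dvd_by_order[OF \<open>N \<noteq> 0\<close>])
    fix w assume w: "w \<in> set l0"
    then have wb: "w \<in> ball 0 1" and wc: "w \<in> cball 0 1" using 0(3) by auto
    have "zorder B0 w = int (order w (smult c0 (root_poly l0)))"
      by (rule zorder_rational[where q = Q0]) (use 0 wc root_poly_nonzero[of l0] in auto)
    also have "\<dots> = int (order w (root_poly l0))"
      using 0(1) by (subst order_smult) auto
    finally have "zorder B0 w = int (order w (root_poly l0))" .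
    moreover have "zorder (\<lambda>z. 1 - of_real t * (of_real a)\<^sup>2 * B1 z * B2 z) w = int (order w N)"
      by (rule zorder_rational[OF \<open>N \<noteq> 0\<close>, where q = "Q1 * Q2"])
         (use 1(5) 2(5) wc poly_N in auto)
    moreover have "B0 w = 0"
      using w poly_root_poly_eq_0_iff[of l0 w] by (simp add: 0(6))
    ultimately show "order w (root_poly l0) \<le> order w N"
      using assms(8) wb by auto
  qed
  then obtain S where S: "N = root_poly l0 * S" by (rule dvdE)
  interpret blaschke_symbol k t a B0 B1 B2 c0 c1 c2 l0 l1 l2 Q0 Q1 Q2 S
    by unfold_locales (use assms 0 1 2 S N_def in auto)
  obtain r s where "\<forall>i j. numer $ i $ j = r i j * (Q0 * Q2) + s i j * root_poly l1 \<and> degree (r i j) < k"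
    using ex_split by blast
  then interpret blaschke_symbol_split k t a B0 B1 B2 c0 c1 c2 l0 l1 l2 Q0 Q1 Q2 S r s
    by unfold_locales auto
  have "\<Psi> = symbol"
    by (simp add: assms(9) symbol_def[abs_def] framed_diag_def frame_def)
  then have \<Phi>: "\<Phi> = P_minus symbol" by (simp add: assms(10))
  have "mcmillan_degree \<Phi> k"
    unfolding mcmillan_degree_def \<Phi> using rational_degree_anti_part
    by (intro exI[of _ anti_part] conjI AE_I2) (simp_all add: P_minus_symbol(1))
  moreover have "mcmillan_degree (\<lambda>z. - analytic_part z) (2 * k - 3)"
    unfolding mcmillan_degree_def using rational_degree_approximant
    by (intro exI[of _ "\<lambda>z. - analytic_part z"]) simp
  ultimately show ?thesis
    using superoptimal unfolding \<Phi> by blast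
qed

end
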